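(* There exists an absolute constant $c>0$ such that the following holds for every prime $p$. Let $\mathcal{I}=\{n+1,n+2,\ldots,n+N\}\pmod p\subset\mathbb{F}_p$ be an interval with $|\mathcal{I}|<cp$, and suppose $\mathcal{I}$ has a nontrivial multiplicative decomposition. Then either $$\mathcal{I}=\pm\{3^*-1,\,3^*,\,3^*+1\}\pmod p,$$ or $$\mathcal{I}=-\mathcal{I}.$$ Moreover, in the latter case, for any sets $\mathcal{A},\mathcal{B}\subset\mathbb{F}_p$ with $|\mathcal{A}|\ge2$, $|\mathcal{B}|\ge2$ and $\mathcal{I}\setminus\{0\}=\mathcal{A}\mathcal{B}$, one of the sets $\mathcal{A}$ or $\mathcal{B}$ coincides with $\{-r,r\}$ for some residue class $r\in\mathbb{F}_p$.
   Context: $\mathbb{F}_p$ is the field of residues modulo the prime $p$. For $\mathcal{A},\mathcal{B}\subset\mathbb{F}_p$, $\mathcal{A}\mathcal{B}=\{ab:\ a\in\mathcal{A},\ b\in\mathcal{B}\}$, and $-\mathcal{S}=\{-s: s\in\mathcal{S}\}$. An interval in $\mathbb{F}_p$ is a set of the form $\{n+1,n+2,\ldots,n+N\}\pmod p$ with integers $n$ and $N\ge 1$. A set $\mathcal{S}\subset\mathbb{F}_p$ is said to have a nontrivial multiplicative decomposition if $\mathcal{S}\setminus\{0\}=\mathcal{A}\mathcal{B}$ for some sets $\mathcal{A},\mathcal{B}\subset\mathbb{F}_p$ with $|\mathcal{A}|\ge2$ and $|\mathcal{B}|\ge2$. For an integer $m$ not divisible by $p$, $m^*$ denotes the multiplicative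 inverse of $m$ modulo $p$. *)

theory Defs
  imports Complex_Main "HOL-Number_Theory.Residues"
begin

text \<open>
  The field of residues modulo a prime \<open>p\<close> is \<^term>\<open>residue_ring (int p)\<close>, whose elements are the
  canonical representatives \<open>0, \<dots>, p - 1\<close>. Products of sets are formed with the library's
  \<^const>\<open>set_mult\<close>.
\<close>

abbreviation Fp :: "nat \<Rightarrow> int ring" where
  "Fp p \<equiv> residue_ring (int p)"

definition neg_set :: "nat \<Rightarrow> int set \<Rightarrow> int set" where
  "neg_set p S = {\<ominus>\<^bsub>Fp p\<^esub> s | s. s \<in> S}"

definition interval_mod :: "nat \<Rightarrow> int \<Rightarrow> nat \<Rightarrow> int set" where
  "interval_mod p n N = {(n + int i) mod int p | i. 1 \<le> i \<and> i \<le> N}"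

definition nontrivial_mult_decomp_by :: "nat \<Rightarrow> int set \<Rightarrow> int set \<Rightarrow> int set \<Rightarrow> bool" where
  "nontrivial_mult_decomp_by p S A B \<longleftrightarrow>
     A \<subseteq> carrier (Fp p) \<and> B \<subseteq> carrier (Fp p) \<and> card A \<ge> 2 \<and> card B \<ge> 2 \<and>
     S - {\<zero>\<^bsub>Fp p\<^esub>} = A <#>\<^bsub>Fp p\<^esub> B"

definition has_nontrivial_mult_decomp :: "nat \<Rightarrow> int set \<Rightarrow> bool" where
  "has_nontrivial_mult_decomp p S \<longleftrightarrow> (\<exists>A B. nontrivial_mult_decomp_by p S A B)"

text \<open>The inverse of the class of \<open>m\<close>; meaningful only when \<open>p\<close> does not divide \<open>m\<close>.\<close>

definition inv_mod :: "nat \<Rightarrow> int \<Rightarrow> int" where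
  "inv_mod p m = inv\<^bsub>Fp p\<^esub> (m mod int p)"

definition exceptional_set :: "nat \<Rightarrow> int set" where
  "exceptional_set p =
     {inv_mod p 3 \<ominus>\<^bsub>Fp p\<^esub> \<one>\<^bsub>Fp p\<^esub>, inv_mod p 3, inv_mod p 3 \<oplus>\<^bsub>Fp p\<^esub> \<one>\<^bsub>Fp p\<^esub>}"

end

theory Submission
  imports Defs "HOL-Library.Set_Algebras" "HOL-Computational_Algebra.Group_Closure"
begin

text \<open>
  Let \<open>I - {0} = AB\<close> with \<open>|I| = N < cp\<close>. All products \<open>(a - a')b\<close> lie in \<open>[-N, N]\<close>, so
  \<open>k(A - A)\<close> times \<open>B\<close> stays in \<open>[-kN, kN]\<close>, and orthogonality of characters gives
  \<open>|k(A - A)| |B| \<le> 2p\<close> whenever \<open>8kN \<le> p\<close>. As \<open>|A| |B| \<ge> N - 1\<close>, the sumset \<open>k(A - A)\<close> has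
  only \<open>O(k|A|)\<close> elements for \<open>k\<close> of order \<open>p / N\<close>. Multiplication by an element of \<open>B\<close> moves
  \<open>A - A\<close> into the integers \<open>[-N, N]\<close> without wrap-around, and there such slow growth forces a
  bounded sumset of \<open>A - A\<close> to fill a progression \<open>u[-l, l]\<close> containing \<open>A - A\<close>, with \<open>l\<close> at least
  of order \<open>|A|\<close>; likewise \<open>v[-l', l']\<close> for \<open>B\<close>.

  Then \<open>vA\<close>, \<open>uB\<close> and \<open>g = uv\<close> are represented by integers so small that \<open>(vA)(uB) = gI - {0}\<close> is
  an identity of sets of integers, where \<open>gI\<close> is a progression with difference \<open>g\<close> and the elements
  of each factor are congruent modulo \<open>g\<close>. Comparing the element of largest absolute value of that
  progression with its neighbour leaves only a factor \<open>{-r, r}\<close> or the progression \<open>\<plusminus>{-2, 1, 4}\<close>.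
\<close>

section \<open>Products of integer sets forming a progression\<close>

definition progression :: "int \<Rightarrow> int \<Rightarrow> nat \<Rightarrow> int set" where
  "progression n g N = (\<lambda>i. n + g * int i) ` {1..N}"

lemma progression_rev: "progression n g N = (\<lambda>j. n + g * int N - g * int j) ` {..<N}"
proof -
  have "{1..N} = (\<lambda>j. N - j) ` {..<N}"
  proof (intro equalityI subsetI)
    fix i assume "i \<in> {1..N}"
    then show "i \<in> (\<lambda>j. N - j) ` {..<N}" by (intro image_eqI[of _ _ "N - i"]) auto
  qed auto
  then have "progression n g N = (\<lambda>j. n + g * int (N - j)) ` {..<N}"
    unfolding progression_def by (simp only: image_image)
  also have "\<dots> = (\<lambda>j. n + g * int N - g * int j) ` {..<N}"
    by (intro image_cong refl) (simp add: of_nat_diff algebra_simps)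
  finally show ?thesis .
qed

lemma uminus_progression:
  "uminus ` progression n g N = progression (- n - g * (int N + 1)) g N"
proof -
  have "progression (- n - g * (int N + 1)) g N =
      (\<lambda>j. - n - g * (int N + 1) + g * int (Suc j)) ` {..<N}"
    unfolding progression_def image_Suc_lessThan[symmetric] image_image ..
  also have "\<dots> = (\<lambda>j. - (n + g * int N - g * int j)) ` {..<N}"
    by (simp add: algebra_simps)
  finally show ?thesis unfolding progression_rev[of n] image_image ..
qed

lemma eq_pair_if_card_ge_2:
  assumes "2 \<le> card S" "S \<subseteq> {x, y}"
  shows "S = {x, y}"
  using card_seteq[of "{x, y}" S] assms by (simp add: card_insert_if split: if_splits)

locale dominated_class =
  fixes g a :: int and A :: "int set"
  assumes modulus_pos: "0 < g"
    and cong: "x \<in> A \<Longrightarrow> y \<in> A \<Longrightarrow> [x = y] (mod g)"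
    and top_mem: "a \<in> A"
    and abs_le_top: "x \<in> A \<Longrightarrow> \<bar>x\<bar> \<le> a"
    and zero_notin: "0 \<notin> A"
    and not_subset_antipodal: "\<not> A \<subseteq> {- a, a}"
begin

lemma modulus_dvd_top_diff: "x \<in> A \<Longrightarrow> g dvd a - x"
  using cong[OF top_mem] by (simp add: cong_iff_dvd_diff)

lemma eq_top_or_le: "x \<in> A \<Longrightarrow> x = a \<or> x \<le> a - g"
  using modulus_dvd_top_diff[of x] abs_le_top[of x] zdvd_imp_le[of g "a - x"] by force

lemma two_le_top: "2 \<le> a"
proof (rule ccontr)
  assume "\<not> 2 \<le> a"
  then have "\<bar>x\<bar> = a" if "x \<in> A" for x
    using abs_le_top[OF that] that zero_notin abs_le_top[OF top_mem] by (cases "x = 0") auto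
  then show False using not_subset_antipodal by force
qed

lemma modulus_less: "g < 2 * a"
proof (rule ccontr)
  assume "\<not> g < 2 * a"
  then have "x = a \<or> x = - a" if "x \<in> A" for x
    using eq_top_or_le[OF that] abs_le_top[OF that] by linarith
  then show False using not_subset_antipodal by blast
qed

lemma top_diff_quotient_not_dvd_2:
  assumes "- a \<in> A" "2 * a = g * m"
  shows "\<not> m dvd 2"
proof
  assume "m dvd 2"
  then have "m \<le> 2" by (simp add: zdvd_imp_le)
  moreover have "g * 1 < g * m" using assms(2) modulus_less by simp
  then have "1 < m" using mult_less_cancel_left_pos modulus_pos by blast
  ultimately have "m = 2" by simp
  then have "g = a" using assms(2) by simp
  have "x = a \<or> x = - a" if "x \<in> A" for x
  proof -
    have "g dvd x" using modulus_dvd_top_diff[OF that] \<open>g = a\<close> by (simp add: dvd_diff_right_iff)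
    moreover have "x \<noteq> 0" using that zero_notin by blast
    ultimately have "g \<le> \<bar>x\<bar>" using dvd_imp_le_int modulus_pos by force
    then show ?thesis using abs_le_top[OF that] \<open>g = a\<close> by linarith
  qed
  then show False using not_subset_antipodal by blast
qed

lemma subset_if_modulus_eq:
  assumes "g = 2 * a - 1"
  shows "A \<subseteq> {a, 1 - a}"
proof
  fix x assume x: "x \<in> A"
  obtain m where m: "a - x = g * m" using modulus_dvd_top_diff[OF x] by (auto elim: dvdE)
  have "0 \<le> g * m" "g * m < g * 2" using m abs_le_top[OF x] assms two_le_top by auto
  then have "m = 0 \<or> m = 1" using modulus_pos by (auto simp: zero_le_mult_iff)
  then show "x \<in> {a, 1 - a}" using m assms by auto
qed

end

locale dominated_product = A: dominated_class g a A + B: dominated_class g b B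
  for g a b :: int and A B :: "int set" +
  fixes n :: int and N :: nat
  assumes product: "A * B = progression n g N - {0}"
begin

lemma abs_product_le:
  assumes "z \<in> A * B"
  shows "\<bar>z\<bar> \<le> a * b"
proof -
  obtain x y where "z = x * y" "x \<in> A" "y \<in> B" using assms by (rule set_times_elim)
  then show ?thesis
    using A.abs_le_top[of x] B.abs_le_top[of y] A.two_le_top
    by (auto simp: abs_mult intro!: mult_mono)
qed

lemma modulus_less_top: "g < a * b"
proof -
  have "a * 2 \<le> a * b" using A.two_le_top B.two_le_top by (intro mult_left_mono) auto
  then show ?thesis using A.modulus_less by linarith
qed

lemma top_eq: "a * b = n + g * int N"
proof -
  have "a * b \<in> progression n g N" using A.top_mem B.top_mem product by blast
  then obtain i where "a * b = n + g * int i" "i \<in> {1..N}" unfolding progression_def by blast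
  then have i: "a * b = n + g * int i" "1 \<le> i" "i \<le> N" by auto
  have le: "g * int i \<le> g * int N" using i A.modulus_pos by simp
  then have "n + g * int N \<noteq> 0" using i(1) modulus_less_top A.modulus_pos by linarith
  then have "n + g * int N \<in> A * B"
    unfolding product progression_def using i by auto
  then have "n + g * int N \<le> a * b" using abs_product_le by fastforce
  then show ?thesis using le i(1) by linarith
qed

lemma product_eq: "A * B = (\<lambda>j. a * b - g * int j) ` {..<N} - {0}"
  unfolding product progression_rev top_eq ..

lemma two_le_length: "2 \<le> N"
proof -
  obtain x where x: "x \<in> A" "x \<noteq> a" using A.not_subset_antipodal by blast
  have "x * b \<in> A * B" using x(1) B.top_mem by blast
  then obtain j where "x * b = a * b - g * int j" "j < N" unfolding product_eq by auto
  moreover from this have "j \<noteq> 0" using x(2) B.two_le_top by (intro notI) simp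
  ultimately show ?thesis by linarith
qed

lemma positive_product_ne_second:
  assumes "x \<in> A" "y \<in> B" "0 < x" "0 < y"
  shows "x * y \<noteq> a * b - g"
proof (cases "x = a")
  case True
  show ?thesis
  proof
    assume eq: "x * y = a * b - g"
    then have "y \<le> b - g" using B.eq_top_or_le[OF assms(2)] True A.modulus_pos by auto
    then have "a * y \<le> a * (b - g)" using A.two_le_top by (intro mult_left_mono) auto
    then have "a * g \<le> g" using eq True by (simp add: right_diff_distrib)
    then show False using A.two_le_top A.modulus_pos by simp
  qed
next
  case False
  then have "x \<le> a - g" using A.eq_top_or_le[OF assms(1)] by blast
  moreover have "y \<le> b" using B.abs_le_top[OF assms(2)] by simp
  ultimately have "x * y \<le> (a - g) * b" using assms by (intro mult_mono) auto
  moreover have "g * 2 \<le> g * b" using B.two_le_top A.modulus_pos by (intro mult_left_mono) auto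
  ultimately show ?thesis using A.modulus_pos unfolding left_diff_distrib by linarith
qed

lemma second_eq_negative_product:
  obtains x y where "x \<in> A" "y \<in> B" "x * y = a * b - g" "x < 0" "y < 0"
proof -
  have "a * b - g * int 1 \<in> A * B"
    unfolding product_eq using two_le_length modulus_less_top by force
  then obtain x y where xy: "x \<in> A" "y \<in> B" "x * y = a * b - g" by (auto elim: set_times_elim)
  then have "0 < x * y" using modulus_less_top by simp
  then have "x < 0 \<and> y < 0"
    using positive_product_ne_second[OF xy(1,2)] xy(3) unfolding zero_less_mult_iff by blast
  then show thesis using xy that by blast
qed

text \<open>
  With \<open>a - x = g m\<close> and \<open>b - y = g m'\<close>, the identity
  \<open>2 (a b - x y) = (a + x) (b - y) + (b + y) (a - x)\<close>
  turns \<open>x y = a b - g\<close> into \<open>(a + x) m' + (b + y) m = 2\<close>.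
\<close>

lemma modulus_eq: "g = 2 * a - 1" "g = 2 * b - 1" and one_minus_top_mem: "1 - a \<in> A"
proof -
  obtain x y where xy: "x \<in> A" "y \<in> B" "x * y = a * b - g" and neg: "x < 0" "y < 0"
    by (rule second_eq_negative_product)
  obtain m where m: "a - x = g * m" using A.modulus_dvd_top_diff[OF xy(1)] by (auto elim: dvdE)
  obtain m' where m': "b - y = g * m'" using B.modulus_dvd_top_diff[OF xy(2)] by (auto elim: dvdE)
  have "0 < g * m" "0 < g * m'" using m m' neg A.two_le_top B.two_le_top by linarith+
  then have m_pos: "0 < m" "0 < m'" using zero_less_mult_pos A.modulus_pos by blast+
  have "g * ((a + x) * m' + (b + y) * m) = (a + x) * (b - y) + (b + y) * (a - x)"
    unfolding m m' by (simp add: algebra_simps)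
  also have "\<dots> = 2 * (a * b - x * y)" by (simp add: algebra_simps)
  also have "\<dots> = g * 2" using xy(3) by simp
  finally have sum: "(a + x) * m' + (b + y) * m = 2" using A.modulus_pos by simp
  have x_ne: "a + x \<noteq> 0"
  proof
    assume "a + x = 0"
    then have "m dvd 2" using sum by (metis add_0 dvd_triv_right mult_zero_left)
    moreover have "- a = x" using \<open>a + x = 0\<close> by simp
    ultimately show False using A.top_diff_quotient_not_dvd_2[of m] xy(1) m by simp
  qed
  have y_ne: "b + y \<noteq> 0"
  proof
    assume "b + y = 0"
    then have "m' dvd 2" using sum by (metis add.right_neutral dvd_triv_right mult_zero_left)
    moreover have "- b = y" using \<open>b + y = 0\<close> by simp
    ultimately show False using B.top_diff_quotient_not_dvd_2[of m'] xy(2) m' by simp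
  qed
  have pos: "1 \<le> a + x" "1 \<le> b + y" "1 \<le> m" "1 \<le> m'"
    using x_ne y_ne A.abs_le_top[OF xy(1)] B.abs_le_top[OF xy(2)] m_pos by linarith+
  then have "a + x \<le> (a + x) * m'" "m' \<le> (a + x) * m'" "b + y \<le> (b + y) * m" "m \<le> (b + y) * m"
    by (simp_all add: mult_le_cancel_left1 mult_le_cancel_right1)
  then have "a + x = 1" "b + y = 1" "m = 1" "m' = 1" using sum pos by linarith+
  then have "x = 1 - a" "y = 1 - b" "a - x = g" "b - y = g" using m m' by simp_all
  then show "g = 2 * a - 1" "g = 2 * b - 1" "1 - a \<in> A" using xy(1) by simp_all
qed

lemma tops_eq: "b = a"
  using modulus_eq by simp

lemma index_cases:
  assumes "j < N"
  shows "int j = 0 \<or> int j = 1 \<or> int j = a"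
proof -
  have "a * b - g * int j \<noteq> 0"
  proof
    assume "a * b - g * int j = 0"
    then have "a * a = g * int j" using tops_eq by simp
    then have "g * (4 * int j - (2 * a + 1)) = 4 * (a * a) - g * (2 * a + 1)"
      by (simp add: algebra_simps)
    also have "\<dots> = 1" unfolding modulus_eq(1) by (simp add: algebra_simps)
    finally have "g dvd 1" by (metis dvd_triv_left)
    then show False using modulus_eq(1) A.two_le_top by simp
  qed
  then have "a * b - g * int j \<in> A * B" unfolding product_eq using assms by blast
  then obtain x y where "a * b - g * int j = x * y" "x \<in> A" "y \<in> B" by (rule set_times_elim)
  then have xy: "a * b - g * int j = x * y" "x \<in> {a, 1 - a}" "y \<in> {a, 1 - a}"
    using A.subset_if_modulus_eq[OF modulus_eq(1)] B.subset_if_modulus_eq[OF modulus_eq(2)] tops_eq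
    by auto
  have "a * a = a * a - g * 0" "(1 - a) * a = a * a - g * a" "(1 - a) * (1 - a) = a * a - g * 1"
    unfolding modulus_eq(1) by (simp_all add: algebra_simps)
  then have "x * y \<in> {a * a - g * 0, a * a - g * 1, a * a - g * a}"
    using xy(2,3) mult.commute[of a "1 - a"] by auto
  then have "g * int j = g * 0 \<or> g * int j = g * 1 \<or> g * int j = g * a" using xy(1) tops_eq by auto
  then show ?thesis using A.modulus_pos by simp
qed

lemma exceptional_shape: "N = 3 \<and> 3 * (n + 2 * g) = g"
proof -
  have "(1 - a) * b \<in> A * B" using one_minus_top_mem B.top_mem by blast
  then obtain j where j: "(1 - a) * b = a * b - g * int j" "j < N" unfolding product_eq by auto
  then have "g * int j = (2 * a - 1) * b" by (simp add: algebra_simps)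
  then have "g * int j = g * a" using tops_eq modulus_eq(1) by simp
  then have "int j = a" using A.modulus_pos by simp
  then have "2 < N" using j(2) A.two_le_top by linarith
  then have "a = 2" using index_cases[of 2] by simp
  then have "\<not> 3 < N" using index_cases[of 3] by auto
  then have "N = 3" using \<open>2 < N\<close> by linarith
  then show ?thesis using top_eq tops_eq modulus_eq(1) \<open>a = 2\<close> by simp
qed

end

lemma dominated_class_sgn_times:
  assumes g: "0 < g" and cong: "\<And>x y. x \<in> A \<Longrightarrow> y \<in> A \<Longrightarrow> [x = y] (mod g)"
    and card: "2 \<le> card A" and zero: "0 \<notin> A" and not_antipodal: "\<nexists>r. A = {- r, r}"
  obtains e a where "e \<in> {1, - 1}" "dominated_class g a (e *o A)"
proof -
  have "finite A" "A \<noteq> {}" using card by (auto intro: card_ge_0_finite)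
  then obtain a where a: "a \<in> A" "\<And>x. x \<in> A \<Longrightarrow> \<bar>x\<bar> \<le> \<bar>a\<bar>"
    using ex_is_arg_min_if_finite[of A "\<lambda>x. - \<bar>x\<bar>"] by (auto simp: is_arg_min_linorder)
  then have "a \<noteq> 0" using zero by blast
  have "\<not> A \<subseteq> {- a, a}" using eq_pair_if_card_ge_2[OF card] not_antipodal by blast
  then obtain x where x: "x \<in> A" "x \<noteq> a" "x \<noteq> - a" by blast
  have "dominated_class g \<bar>a\<bar> (sgn a *o A)"
  proof
    show "\<bar>a\<bar> \<in> sgn a *o A"
      unfolding abs_sgn using a(1) by (auto simp: mult.commute elt_set_times_def)
    show "0 \<notin> sgn a *o A" using zero \<open>a \<noteq> 0\<close> by (auto simp: elt_set_times_def sgn_eq_0_iff)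
    show "\<not> sgn a *o A \<subseteq> {- \<bar>a\<bar>, \<bar>a\<bar>}"
      using x \<open>a \<noteq> 0\<close> by (auto simp: elt_set_times_def sgn_if subset_iff split: if_splits)
  qed (use g cong a(2) \<open>a \<noteq> 0\<close> in
      \<open>auto simp: elt_set_times_def abs_mult abs_sgn_eq intro: cong_scalar_left\<close>)
  moreover have "sgn a \<in> {1, - 1}" using \<open>a \<noteq> 0\<close> by (simp add: sgn_if)
  ultimately show thesis using that by blast
qed

theorem progression_product_cases:
  fixes A B :: "int set"
  assumes g: "0 < g"
    and cong: "\<And>x y. x \<in> A \<Longrightarrow> y \<in> A \<Longrightarrow> [x = y] (mod g)" "\<And>x y. x \<in> B \<Longrightarrow> y \<in> B \<Longrightarrow> [x = y] (mod g)"
    and card: "2 \<le> card A" "2 \<le> card B"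
    and product: "A * B = progression n g N - {0}"
  shows "(\<exists>r. A = {- r, r}) \<or> (\<exists>r. B = {- r, r}) \<or> (N = 3 \<and> \<bar>3 * (n + 2 * g)\<bar> = g)"
proof (rule ccontr)
  assume not_cases: "\<not> ?thesis"
  have "0 \<notin> A * B" unfolding product by simp
  moreover obtain a b where "a \<in> A" "b \<in> B" using card by fastforce
  ultimately have "0 \<notin> A" "0 \<notin> B"
    using set_times_intro[of 0 A b B] set_times_intro[of a A 0 B] by auto
  obtain e a where e: "e \<in> {1, - 1}" and A: "dominated_class g a (e *o A)"
    using dominated_class_sgn_times[OF g cong(1) card(1) \<open>0 \<notin> A\<close>] not_cases by blast
  obtain f b where f: "f \<in> {1, - 1}" and B: "dominated_class g b (f *o B)"
    using dominated_class_sgn_times[OF g cong(2) card(2) \<open>0 \<notin> B\<close>] not_cases by blast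
  consider (same_sign) "e * f = 1" | (opposite_sign) "e * f = - 1" using e f by auto
  then show False
  proof cases
    case same_sign
    then have "(e *o A) * (f *o B) = progression n g N - {0}"
      by (simp add: set_times_rearrange product)
    then interpret dominated_product g a b "e *o A" "f *o B" n N
      using A B by (simp add: dominated_product_def dominated_product_axioms_def)
    show False using exceptional_shape not_cases g by simp
  next
    case opposite_sign
    then have "(e *o A) * (f *o B) = uminus ` (progression n g N - {0})"
      unfolding set_times_rearrange product by (auto simp: elt_set_times_def)
    also have "\<dots> = progression (- n - g * (int N + 1)) g N - {0}"
      by (simp add: image_set_diff uminus_progression)
    finally interpret dominated_product g a b "e *o A" "f *o B" "- n - g * (int N + 1)" N
      using A B by (simp add: dominated_product_def dominated_product_axioms_def)
    have "N = 3" "3 * (n + 2 * g) = - g" using exceptional_shape by auto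
    then show False using not_cases g by simp
  qed
qed

section \<open>Sets of integers up to congruence\<close>

definition cong_subset :: "int set \<Rightarrow> int set \<Rightarrow> int \<Rightarrow> bool"
    (\<open>(\<open>indent=1 notation=\<open>mixfix cong_subset\<close>\<close>[_ \<subseteq> _] '(' mod _'))\<close>)
  where "[S \<subseteq> T] (mod m) \<longleftrightarrow> (\<forall>s\<in>S. \<exists>t\<in>T. [s = t] (mod m))"

lemma cong_subset_iff_image_mod:
  "[S \<subseteq> T] (mod m) \<longleftrightarrow> (\<lambda>x. x mod m) ` S \<subseteq> (\<lambda>x. x mod m) ` T"
  unfolding cong_subset_def cong_def by (auto simp: image_subset_iff image_iff)

lemma cong_subsetE:
  assumes "[S \<subseteq> T] (mod m)" "s \<in> S"
  obtains t where "t \<in> T" "[s = t] (mod m)"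
  using assms unfolding cong_subset_def by blast

lemma subset_imp_cong_subset: "S \<subseteq> T \<Longrightarrow> [S \<subseteq> T] (mod m)"
  unfolding cong_subset_def using cong_refl by blast

lemma cong_subset_refl [simp]: "[S \<subseteq> S] (mod m)"
  by (simp add: subset_imp_cong_subset)

lemma cong_subset_trans [trans]: "[S \<subseteq> T] (mod m) \<Longrightarrow> [T \<subseteq> U] (mod m) \<Longrightarrow> [S \<subseteq> U] (mod m)"
  unfolding cong_subset_iff_image_mod by (rule subset_trans)

lemma cong_subset_subset_trans [trans]: "[S \<subseteq> T] (mod m) \<Longrightarrow> T \<subseteq> U \<Longrightarrow> [S \<subseteq> U] (mod m)"
  using cong_subset_trans subset_imp_cong_subset by blast

lemma subset_cong_subset_trans [trans]: "S \<subseteq> T \<Longrightarrow> [T \<subseteq> U] (mod m) \<Longrightarrow> [S \<subseteq> U] (mod m)"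
  using cong_subset_trans subset_imp_cong_subset by blast

lemma cong_subset_plus:
  assumes "[S \<subseteq> S'] (mod m)" "[T \<subseteq> T'] (mod m)"
  shows "[S + T \<subseteq> S' + T'] (mod m)"
  using assms unfolding cong_subset_def set_plus_def by simp (metis cong_add)

lemma cong_subset_times:
  assumes "[S \<subseteq> S'] (mod m)" "[T \<subseteq> T'] (mod m)"
  shows "[S * T \<subseteq> S' * T'] (mod m)"
  using assms unfolding cong_subset_def set_times_def by simp (metis cong_mult)

lemma cong_subset_elt_set_times:
  assumes "[a = b] (mod m)" "[S \<subseteq> T] (mod m)"
  shows "[a *o S \<subseteq> b *o T] (mod m)"
  unfolding cong_subset_def elt_set_times_def
  using assms by (auto elim!: cong_subsetE intro!: cong_mult)

lemma cong_subset_elt_set_times_if_cong_1: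
  assumes "[w = 1] (mod m)"
  shows "[w *o S \<subseteq> S] (mod m)" "[S \<subseteq> w *o S] (mod m)"
  using cong_subset_elt_set_times[OF assms, of S S]
    cong_subset_elt_set_times[OF cong_sym[OF assms], of S S]
  by simp_all

lemma cong_subset_imp_subset:
  assumes "[S \<subseteq> T] (mod m)" "S \<subseteq> {- M..M}" "T \<subseteq> {- M'..M'}" "M + M' < m"
  shows "S \<subseteq> T"
proof
  fix s assume "s \<in> S"
  with assms(1) obtain t where t: "t \<in> T" "[s = t] (mod m)" by (rule cong_subsetE)
  then have "m dvd s - t" by (simp add: cong_iff_dvd_diff)
  moreover have "\<bar>s - t\<bar> < m" using \<open>s \<in> S\<close> t(1) assms(2-4) by fastforce
  ultimately have "s = t" using dvd_imp_le_int[of "s - t" m] by fastforce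
  then show "s \<in> T" using t(1) by simp
qed

lemma finite_if_inj_on_mod:
  fixes m :: int
  assumes "0 < m" "inj_on (\<lambda>x. x mod m) S"
  shows "finite S"
proof -
  have "(\<lambda>x. x mod m) ` S \<subseteq> {0..<m}" using assms(1) by auto
  then have "finite ((\<lambda>x. x mod m) ` S)" using finite_subset by blast
  then show ?thesis using assms(2) by (rule finite_imageD)
qed

lemma inj_on_mod_if_bounded:
  fixes m :: int
  assumes "S \<subseteq> {- M..M}" "2 * M < m"
  shows "inj_on (\<lambda>x. x mod m) S"
proof (rule inj_onI)
  fix x y assume xy: "x \<in> S" "y \<in> S" "x mod m = y mod m"
  then have "[{x} \<subseteq> {y}] (mod m)" by (simp add: cong_subset_def cong_def)
  then have "{x} \<subseteq> {y}" by (rule cong_subset_imp_subset) (use xy assms in auto)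
  then show "x = y" by simp
qed

lemma inj_on_mod_if_residues: "A \<subseteq> {0<..<m} \<Longrightarrow> inj_on (\<lambda>x. x mod m) A" for m :: int
  by (rule inj_onI) (metis greaterThanLessThan_iff less_le mod_pos_pos_trivial subsetD)

lemma inj_on_mod_elt_set_times:
  fixes m :: int
  assumes "inj_on (\<lambda>x. x mod m) S" "coprime w m"
  shows "inj_on (\<lambda>x. x mod m) (w *o S)"
  using assms by (auto simp: inj_on_def elt_set_times_def cong_mult_lcancel simp flip: cong_def)

lemma card_elt_set_times_if_coprime:
  fixes m :: int
  assumes "inj_on (\<lambda>x. x mod m) S" "coprime w m"
  shows "card (w *o S) = card S"
proof -
  have "inj_on ((*) w) S"
    using assms by (intro inj_onI) (metis cong_def cong_mult_lcancel inj_onD)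
  then have "card ((*) w ` S) = card S" by (rule card_image)
  moreover have "w *o S = (*) w ` S" by (auto simp: elt_set_times_def)
  ultimately show ?thesis by simp
qed

lemma card_le_if_cong_subset:
  assumes "[S \<subseteq> T] (mod m)" "inj_on (\<lambda>x. x mod m) S" "finite T"
  shows "card S \<le> card T"
proof -
  have "card S = card ((\<lambda>x. x mod m) ` S)" using assms(2) by (simp add: card_image)
  also have "\<dots> \<le> card ((\<lambda>x. x mod m) ` T)"
    using assms(1,3) by (intro card_mono) (simp_all add: cong_subset_iff_image_mod)
  also have "\<dots> \<le> card T" using assms(3) by (rule card_image_le)
  finally show ?thesis .
qed

lemma coprime_if_cong_mult_1: "[b * c = 1] (mod m) \<Longrightarrow> coprime b m" for b c m :: int
  using cong_imp_coprime[of 1 "b * c" m] by (simp add: cong_sym)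

lemma coprime_if_residue:
  fixes m :: int
  assumes "prime m" "x \<in> {0<..<m}"
  shows "coprime x m"
  using assms by (metis coprime_commute greaterThanLessThan_iff prime_imp_coprime zdvd_not_zless)

definition small_reps :: "int \<Rightarrow> int \<Rightarrow> int set \<Rightarrow> int set" where
  "small_reps m M S = {y \<in> {- M..M}. \<exists>s\<in>S. [y = s] (mod m)}"

lemma small_reps_subset: "small_reps m M S \<subseteq> {- M..M}"
  unfolding small_reps_def by blast

lemma finite_small_reps: "finite (small_reps m M S)"
  by (rule finite_subset[OF small_reps_subset]) simp

lemma small_reps_cong_subset: "[small_reps m M S \<subseteq> S] (mod m)"
  unfolding small_reps_def cong_subset_def by auto

lemma cong_subset_small_reps:
  assumes "[S \<subseteq> {- M..M}] (mod m)"
  shows "[S \<subseteq> small_reps m M S] (mod m)"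
  unfolding cong_subset_def
proof
  fix s assume "s \<in> S"
  with assms obtain y where "y \<in> {- M..M}" "[s = y] (mod m)" by (rule cong_subsetE)
  then show "\<exists>y\<in>small_reps m M S. [s = y] (mod m)"
    using \<open>s \<in> S\<close> cong_sym unfolding small_reps_def by blast
qed

lemma small_if_multiples_small:
  fixes l m M z :: int
  assumes l: "0 < l" and M: "3 * M < m" and small: "[z *o {- l..l} \<subseteq> {- M..M}] (mod m)"
  obtains y where "[z = y] (mod m)" "\<bar>y\<bar> * l \<le> M"
proof -
  have rep: "\<exists>w. \<bar>w\<bar> \<le> M \<and> [z * i = w] (mod m)" if "\<bar>i\<bar> \<le> l" for i
    using cong_subsetE[OF small set_times_intro2, of i] that
    by (metis abs_le_iff atLeastAtMost_iff minus_le_iff)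
  obtain y where y: "\<bar>y\<bar> \<le> M" "[z = y] (mod m)" using rep[of 1] l by auto
  have "\<bar>y * int i\<bar> \<le> M" if "int i \<le> l" for i
    using that
  proof (induction i)
    case 0
    then show ?case using y by auto
  next
    case (Suc i)
    obtain w where w: "\<bar>w\<bar> \<le> M" "[z * int (Suc i) = w] (mod m)"
      using rep[of "int (Suc i)"] Suc.prems by auto
    have "[y * int (Suc i) = w] (mod m)"
      using cong_trans[OF cong_scalar_right[OF cong_sym[OF y(2)]] w(2)] .
    then have cong: "[{y * int (Suc i)} \<subseteq> {w}] (mod m)" unfolding cong_subset_def by blast
    have "y * int (Suc i) = y * int i + y" by (simp add: algebra_simps)
    then have "\<bar>y * int (Suc i)\<bar> \<le> 2 * M" using Suc y(1) by linarith
    then have "{y * int (Suc i)} \<subseteq> {- (2 * M)..2 * M}" by (auto simp: abs_le_iff)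
    then have "{y * int (Suc i)} \<subseteq> {w}"
      by (rule cong_subset_imp_subset[OF cong, where M' = M]) (use w(1) M in auto)
    then show ?case using w(1) by simp
  qed
  from this[of "nat l"] have "\<bar>y\<bar> * l \<le> M" using l by (simp add: abs_mult)
  then show thesis using y(2) that by blast
qed

section \<open>Iterated sumsets\<close>

primrec sumset :: "nat \<Rightarrow> 'a::comm_monoid_add set \<Rightarrow> 'a set" where
  "sumset 0 S = {0}"
| "sumset (Suc n) S = sumset n S + S"

lemma sumset_add: "sumset (m + n) S = sumset m S + sumset n S"
  by (induction n) (simp_all add: add.assoc)

lemma finite_sumset: "finite S \<Longrightarrow> finite (sumset n S)"
  by (induction n) (simp_all add: finite_set_plus)

lemma sumset_mono: "S \<subseteq> T \<Longrightarrow> sumset n S \<subseteq> sumset n T"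
  by (induction n) (simp_all add: set_plus_mono2)

lemma sumset_increasing:
  assumes "0 \<in> S" "m \<le> n"
  shows "sumset m S \<subseteq> sumset n S"
proof -
  have "0 \<in> sumset k S" for k
    using assms(1) set_plus_intro[of 0 _ 0 S] by (induction k) auto
  then have "sumset m S \<subseteq> sumset (n - m) S + sumset m S" by (rule set_zero_plus2)
  then show ?thesis using assms(2) by (simp flip: sumset_add)
qed

lemma uminus_sumset_subset:
  fixes S :: "'a::ab_group_add set"
  assumes "uminus ` S \<subseteq> S"
  shows "uminus ` sumset n S \<subseteq> sumset n S"
proof (induction n)
  case (Suc n)
  have "uminus ` (sumset n S + S) = uminus ` sumset n S + uminus ` S"
    by (force simp: set_plus_image image_iff)
  also have "\<dots> \<subseteq> sumset n S + S" using Suc assms by (rule set_plus_mono2)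
  finally show ?case by simp
qed simp

lemma of_nat_mult_mem_sumset: "x \<in> S \<Longrightarrow> of_nat n * x \<in> sumset n S" for x :: "'a::comm_semiring_1"
  by (induction n) (auto simp: algebra_simps)

lemma sumset_atLeastAtMost_subset: "sumset n {- M..M} \<subseteq> {- (int n * M)..int n * M}"
proof (induction n)
  case (Suc n)
  then show ?case by (fastforce elim!: set_plus_elim simp: algebra_simps)
qed simp

lemma sumset_times_subset: "sumset n S * T \<subseteq> sumset n (S * T)" for S :: "'a::comm_semiring_1 set"
proof (induction n)
  case (Suc n)
  have "(sumset n S + S) * T \<subseteq> sumset n S * T + S * T"
    unfolding set_times_def set_plus_def by (auto simp: distrib_right) blast
  also have "\<dots> \<subseteq> sumset n (S * T) + S * T" using Suc by (intro set_plus_mono2) auto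
  finally show ?case by simp
qed (auto elim: set_times_elim)

lemma sumset_elt_set_times: "sumset n (a *o S) = a *o sumset n S" for a :: int
proof (induction n)
  case 0
  show ?case by (auto simp: elt_set_times_def)
qed (simp add: set_times_plus_distrib2)

lemma cong_subset_sumset: "[S \<subseteq> T] (mod m) \<Longrightarrow> [sumset n S \<subseteq> sumset n T] (mod m)"
  by (induction n) (simp_all add: cong_subset_plus subset_imp_cong_subset)

lemma cong_subset_sumset_times:
  assumes "[S * T \<subseteq> {- M..M}] (mod m)"
  shows "[sumset n S * T \<subseteq> {- (int n * M)..int n * M}] (mod m)"
proof -
  have "sumset n S * T \<subseteq> sumset n (S * T)" by (rule sumset_times_subset)
  also have "[sumset n (S * T) \<subseteq> sumset n {- M..M}] (mod m)"
    using assms by (rule cong_subset_sumset)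
  also have "sumset n {- M..M} \<subseteq> {- (int n * M)..int n * M}" by (rule sumset_atLeastAtMost_subset)
  finally show ?thesis .
qed

definition diff_set :: "'a::ab_group_add set \<Rightarrow> 'a set" where
  "diff_set S = {x - y |x y. x \<in> S \<and> y \<in> S}"

lemma uminus_diff_set_subset: "uminus ` diff_set S \<subseteq> diff_set S"
  unfolding diff_set_def by force

lemma zero_mem_diff_set: "S \<noteq> {} \<Longrightarrow> 0 \<in> diff_set S"
  unfolding diff_set_def by force

lemma diff_set_times_subset: "diff_set S * T \<subseteq> diff_set (S * T)" for S :: "'a::comm_ring set"
  unfolding diff_set_def
  by (auto elim!: set_times_elim simp: left_diff_distrib) blast

lemma diff_set_elt_set_times_subset: "diff_set (a *o S) \<subseteq> a *o diff_set S" for a :: "'a::comm_ring"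
  unfolding diff_set_def elt_set_times_def by (auto simp flip: right_diff_distrib) blast

lemma cong_subset_diff_set:
  assumes "[S \<subseteq> T] (mod m)"
  shows "[diff_set S \<subseteq> diff_set T] (mod m)"
  unfolding cong_subset_def
proof
  fix d assume "d \<in> diff_set S"
  then obtain x y where "x \<in> S" "y \<in> S" "d = x - y" unfolding diff_set_def by blast
  moreover from this assms obtain x' y' where "x' \<in> T" "y' \<in> T"
    and "[x = x'] (mod m)" "[y = y'] (mod m)"
    by (meson cong_subsetE)
  ultimately show "\<exists>e\<in>diff_set T. [d = e] (mod m)"
    unfolding diff_set_def using cong_diff by blast
qed

lemma diff_set_bounded:
  fixes S :: "int set"
  assumes "S \<subseteq> {- M..M}"
  shows "diff_set S \<subseteq> {- (2 * M)..2 * M}"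
proof
  fix d assume "d \<in> diff_set S"
  then obtain x y where "d = x - y" "x \<in> S" "y \<in> S" unfolding diff_set_def by blast
  moreover from this have "x \<in> {- M..M}" "y \<in> {- M..M}" using assms by blast+
  ultimately show "d \<in> {- (2 * M)..2 * M}" by simp
qed

lemma diff_set_progression_subset:
  assumes "0 \<le> g"
  shows "diff_set (progression n g N) \<subseteq> {- (g * int N)..g * int N}"
proof -
  have bounds: "0 \<le> g * int i" "g * int i \<le> g * int N" if "i \<le> N" for i
    using that assms by (simp_all add: mult_left_mono)
  have "(n + g * int i) - (n + g * int j) \<in> {- (g * int N)..g * int N}" if "i \<le> N" "j \<le> N" for i j
    using bounds[OF that(1)] bounds[OF that(2)] by simp
  then show ?thesis unfolding diff_set_def progression_def by auto
qed

lemma cong_subset_diff_set_progression: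
  assumes "[S \<subseteq> progression n g N] (mod m)" "0 \<le> g"
  shows "[diff_set S \<subseteq> {- (g * int N)..g * int N}] (mod m)"
proof -
  have "[diff_set S \<subseteq> diff_set (progression n g N)] (mod m)"
    using assms(1) by (rule cong_subset_diff_set)
  also have "diff_set (progression n g N) \<subseteq> {- (g * int N)..g * int N}"
    using assms(2) by (rule diff_set_progression_subset)
  finally show ?thesis .
qed

lemma progression_bounded_if_mem:
  assumes "z \<in> progression n g N" "z \<in> {- M..M}" "0 \<le> g"
  shows "progression n g N \<subseteq> {- (M + g * int N)..M + g * int N}"
proof
  fix x assume "x \<in> progression n g N"
  then have "x - z \<in> diff_set (progression n g N)" using assms(1) unfolding diff_set_def by blast
  then have "x - z \<in> {- (g * int N)..g * int N}"
    using diff_set_progression_subset[OF assms(3)] by blast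
  then show "x \<in> {- (M + g * int N)..M + g * int N}" using assms(2) by simp
qed

section \<open>Additive characters\<close>

definition add_char :: "int \<Rightarrow> int \<Rightarrow> complex" where
  "add_char m x = cis (2 * pi * real_of_int x / real_of_int m)"

lemma add_char_add: "add_char m (x + y) = add_char m x * add_char m y"
  unfolding add_char_def cis_mult by (simp add: algebra_simps add_divide_distrib)

lemma add_char_diff: "add_char m (x - y) = add_char m x * cnj (add_char m y)"
  unfolding add_char_def cis_cnj cis_mult by (simp add: algebra_simps diff_divide_distrib)

lemma add_char_of_nat_mult: "add_char m (int t * x) = add_char m x ^ t"
  unfolding add_char_def DeMoivre by (simp add: field_simps)

lemma add_char_eq_1_iff:
  assumes "m \<noteq> 0"
  shows "add_char m x = 1 \<longleftrightarrow> m dvd x"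
proof
  assume "add_char m x = 1"
  then have "cos (2 * pi * real_of_int x / real_of_int m) = 1"
    unfolding add_char_def by (simp add: complex_eq_iff)
  then obtain k :: int where "2 * pi * real_of_int x / real_of_int m = real_of_int k * (2 * pi)"
    by (auto simp: cos_one_2pi_int)
  then have "real_of_int x = real_of_int (k * m)" using assms by (simp add: field_simps)
  then have "x = k * m" by linarith
  then show "m dvd x" by simp
next
  assume "m dvd x"
  then obtain k where "x = m * k" ..
  then have "2 * pi * real_of_int x / real_of_int m = 2 * pi * real_of_int k" using assms by simp
  then show "add_char m x = 1" unfolding add_char_def by (simp only: cis_multiple_2pi Ints_of_int)
qed

lemma add_char_cong:
  assumes "m \<noteq> 0" "[x = y] (mod m)"
  shows "add_char m x = add_char m y"
proof -
  have "add_char m (x - y) = 1" using assms by (simp add: add_char_eq_1_iff cong_iff_dvd_diff)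
  then show ?thesis using add_char_add[of m "x - y" y] by simp
qed

lemma sum_add_char:
  assumes "0 < m"
  shows "(\<Sum>t\<in>{0..<m}. add_char m (t * x)) = (if m dvd x then of_int m else 0)"
proof -
  have "{0..<m} = int ` {..<nat m}"
    using assms by (simp add: image_int_atLeastLessThan lessThan_atLeast0)
  then have "(\<Sum>t\<in>{0..<m}. add_char m (t * x)) = (\<Sum>t<nat m. add_char m x ^ t)"
    by (simp add: sum.reindex add_char_of_nat_mult)
  also have "\<dots> = (if m dvd x then of_int m else 0)"
  proof (cases "m dvd x")
    case True
    then have "add_char m x = 1" using assms by (simp add: add_char_eq_1_iff)
    then show ?thesis using True assms by simp
  next
    case False
    have "add_char m x ^ nat m = add_char m (m * x)"
      using assms add_char_of_nat_mult[of m "nat m" x] by simp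
    also have "\<dots> = 1" using assms by (simp add: add_char_eq_1_iff)
    finally have "add_char m x ^ nat m = 1" .
    then show ?thesis using False assms by (simp add: sum_gp_strict add_char_eq_1_iff)
  qed
  finally show ?thesis .
qed

lemma Parseval_add_char:
  assumes "0 < m" "inj_on (\<lambda>y. y mod m) Y"
  shows "(\<Sum>t\<in>{0..<m}. (cmod (\<Sum>y\<in>Y. add_char m (t * y)))\<^sup>2) = real_of_int m * real (card Y)"
proof -
  have fin: "finite Y" using assms by (rule finite_if_inj_on_mod)
  have "complex_of_real (\<Sum>t\<in>{0..<m}. (cmod (\<Sum>y\<in>Y. add_char m (t * y)))\<^sup>2)
      = (\<Sum>t\<in>{0..<m}. (\<Sum>y\<in>Y. add_char m (t * y)) * cnj (\<Sum>y\<in>Y. add_char m (t * y)))"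
    by (simp only: of_real_sum complex_norm_square)
  also have "\<dots> = (\<Sum>t\<in>{0..<m}. \<Sum>y\<in>Y. \<Sum>y'\<in>Y. add_char m (t * (y - y')))"
    by (simp add: sum_product right_diff_distrib add_char_diff)
  also have "\<dots> = (\<Sum>y\<in>Y. \<Sum>y'\<in>Y. \<Sum>t\<in>{0..<m}. add_char m (t * (y - y')))"
    by (subst sum.swap, intro sum.cong refl sum.swap)
  also have "\<dots> = (\<Sum>y\<in>Y. \<Sum>y'\<in>Y. if y = y' then of_int m else 0)"
  proof (intro sum.cong refl)
    fix y y' assume "y \<in> Y" "y' \<in> Y"
    then have "m dvd (y - y') \<longleftrightarrow> y = y'"
      using assms(2) by (auto simp: inj_on_def simp flip: mod_eq_dvd_iff)
    then show "(\<Sum>t\<in>{0..<m}. add_char m (t * (y - y'))) = (if y = y' then of_int m else 0)"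
      using sum_add_char[OF assms(1)] by simp
  qed
  also have "\<dots> = complex_of_real (real_of_int m * real (card Y))" using fin by simp
  finally show ?thesis unfolding of_real_eq_iff .
qed

lemma Re_add_char_ge:
  assumes "0 < m" "8 * \<bar>x\<bar> \<le> m"
  shows "sqrt 2 / 2 \<le> Re (add_char m x)"
proof -
  have "cos (pi / 4) \<le> cos (2 * pi * \<bar>real_of_int x\<bar> / real_of_int m)"
  proof (rule cos_monotone_0_pi_le)
    have "8 * \<bar>real_of_int x\<bar> \<le> real_of_int m" using assms(2) by linarith
    then show "2 * pi * \<bar>real_of_int x\<bar> / real_of_int m \<le> pi / 4"
      using assms(1) by (simp add: field_simps)
  qed (use assms in auto)
  also have "\<dots> = Re (add_char m x)" unfolding add_char_def by (cases "0 \<le> x") auto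
  finally show ?thesis by (simp add: cos_45)
qed

lemma norm_sum_add_char_ge:
  assumes "0 < m" "8 * M \<le> m" "[x *o Y \<subseteq> {- M..M}] (mod m)"
  shows "(real (card Y))\<^sup>2 / 2 \<le> (cmod (\<Sum>y\<in>Y. add_char m (x * y)))\<^sup>2"
proof -
  have "sqrt 2 / 2 \<le> Re (add_char m (x * y))" if y: "y \<in> Y" for y
  proof -
    obtain w where w: "w \<in> {- M..M}" "[x * y = w] (mod m)"
      by (rule cong_subsetE[OF assms(3) set_times_intro2[OF y]])
    then have "add_char m (x * y) = add_char m w" using assms(1) by (intro add_char_cong) auto
    then show ?thesis using Re_add_char_ge[of m w] w(1) assms(1,2) by auto
  qed
  then have "real (card Y) * (sqrt 2 / 2) \<le> (\<Sum>y\<in>Y. Re (add_char m (x * y)))"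
    by (rule sum_bounded_below)
  also have "\<dots> \<le> cmod (\<Sum>y\<in>Y. add_char m (x * y))"
    using complex_Re_le_cmod[of "\<Sum>y\<in>Y. add_char m (x * y)"] by simp
  finally have "(real (card Y) * (sqrt 2 / 2))\<^sup>2 \<le> (cmod (\<Sum>y\<in>Y. add_char m (x * y)))\<^sup>2"
    by (intro power_mono) auto
  then show ?thesis by (simp add: power_mult_distrib power_divide)
qed

lemma card_times_card_le_if_products_small:
  assumes m: "0 < m" and X: "inj_on (\<lambda>x. x mod m) X" and Y: "inj_on (\<lambda>y. y mod m) Y"
    and small: "[X * Y \<subseteq> {- M..M}] (mod m)" "8 * M \<le> m"
  shows "int (card X * card Y) \<le> 2 * m"
proof (cases "card Y = 0")
  case False
  define S where "S t = (\<Sum>y\<in>Y. add_char m (t * y))" for t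
  have S_mod: "S (x mod m) = S x" for x
    unfolding S_def using m
    by (intro sum.cong refl add_char_cong) (simp_all add: cong_def mod_mult_left_eq)
  have "(real (card Y))\<^sup>2 / 2 \<le> (cmod (S x))\<^sup>2" if "x \<in> X" for x
  proof -
    have "[x *o Y \<subseteq> {- M..M}] (mod m)"
      using subset_cong_subset_trans[OF set_times_mono3[OF that] small(1)] .
    then show ?thesis unfolding S_def by (rule norm_sum_add_char_ge[OF m small(2)])
  qed
  then have "real (card X) * ((real (card Y))\<^sup>2 / 2) \<le> (\<Sum>x\<in>X. (cmod (S x))\<^sup>2)"
    by (rule sum_bounded_below)
  also have "\<dots> = (\<Sum>t\<in>(\<lambda>x. x mod m) ` X. (cmod (S t))\<^sup>2)" using X by (simp add: sum.reindex S_mod)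
  also have "\<dots> \<le> (\<Sum>t\<in>{0..<m}. (cmod (S t))\<^sup>2)" using m by (intro sum_mono2) auto
  also have "\<dots> = real_of_int m * real (card Y)"
    unfolding S_def using m Y by (rule Parseval_add_char)
  finally have "(real (card X) * real (card Y)) * real (card Y)
      \<le> (2 * real_of_int m) * real (card Y)"
    by (simp add: power2_eq_square)
  then have "real (card X) * real (card Y) \<le> 2 * real_of_int m" using False by simp
  then have "real_of_int (int (card X * card Y)) \<le> real_of_int (2 * m)" by simp
  then show ?thesis by (simp only: of_int_le_iff)
qed (use m in simp)

section \<open>Slowly growing sumsets of integers\<close>

lemma group_closure_subset_sumsets:
  assumes "uminus ` D \<subseteq> D"
  shows "group_closure D \<subseteq> (\<Union>n. sumset n D)"
proof
  fix x assume "x \<in> group_closure D"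
  then show "x \<in> (\<Union>n. sumset n D)"
  proof induction
    case (base s)
    then have "s \<in> sumset 0 D \<or> s \<in> sumset (Suc 0) D" by auto
    then show ?case by blast
  next
    case (diff s t)
    then obtain m n where "s \<in> sumset m D" "t \<in> sumset n D" by blast
    moreover from this have "- t \<in> sumset n D" using uminus_sumset_subset[OF assms] by blast
    ultimately have "s + - t \<in> sumset (m + n) D" unfolding sumset_add by (intro set_plus_intro)
    then show ?case by auto
  qed
qed

lemma cong_subset_sumset_stable:
  assumes "0 \<in> D" "[sumset (Suc n) D \<subseteq> sumset n D] (mod m)"
  shows "[sumset k D \<subseteq> sumset n D] (mod m)"
proof (induction k)
  case 0
  show ?case using sumset_increasing[OF assms(1), of 0 n] by (intro subset_imp_cong_subset) simp
next
  case (Suc k)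
  have "[sumset (Suc k) D \<subseteq> sumset (Suc n) D] (mod m)"
    using Suc by (simp add: cong_subset_plus subset_imp_cong_subset)
  then show ?case using assms(2) by (rule cong_subset_trans)
qed

definition card_mod :: "int \<Rightarrow> int set \<Rightarrow> nat" where
  "card_mod m S = card ((\<lambda>x. x mod m) ` S)"

lemma card_mod_elt_set_plus: "card_mod m (z +o S) = card_mod m S"
proof -
  have "(\<lambda>x. x mod m) ` (z +o S) = (\<lambda>r. (z + r) mod m) ` (\<lambda>x. x mod m) ` S"
    unfolding elt_set_plus_def by (auto simp: image_iff mod_add_right_eq)
  moreover have "inj_on (\<lambda>r. (z + r) mod m) ((\<lambda>x. x mod m) ` S)"
    by (rule inj_onI) (auto simp: mod_add_right_eq cong_add_lcancel simp flip: cong_def)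
  ultimately show ?thesis unfolding card_mod_def by (simp add: card_image)
qed

lemma card_mod_sumset_growth:
  assumes fin: "finite D" and zero: "0 \<in> D" and sym: "uminus ` D \<subseteq> D"
    and growing: "\<And>n. n < 3 * s \<Longrightarrow> \<not> [sumset (Suc n) D \<subseteq> sumset n D] (mod m)"
  shows "s * card_mod m D \<le> card_mod m (sumset (3 * s) D)"
  using growing
proof (induction s)
  case (Suc s)
  define R where "R S = (\<lambda>x. x mod m) ` S" for S :: "int set"
  have "\<not> [sumset (Suc (3 * s + 1)) D \<subseteq> sumset (3 * s + 1) D] (mod m)" by (rule Suc.prems) simp
  then obtain z where z: "z \<in> sumset (3 * s + 2) D"
      "\<And>w. w \<in> sumset (3 * s + 1) D \<Longrightarrow> \<not> [z = w] (mod m)"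
    unfolding cong_subset_def by auto
  have disjoint: "R (z +o D) \<inter> R (sumset (3 * s) D) = {}"
  proof (rule ccontr)
    assume "R (z +o D) \<inter> R (sumset (3 * s) D) \<noteq> {}"
    then obtain d w where d: "d \<in> D" and w: "w \<in> sumset (3 * s) D" and cong: "[z + d = w] (mod m)"
      unfolding R_def elt_set_plus_def cong_def by auto
    have "- d \<in> D" using sym d by blast
    then have "w - d \<in> sumset (3 * s + 1) D" using set_plus_intro[OF w, of "- d"] by simp
    moreover have "[z = w - d] (mod m)" using cong_diff[OF cong cong_refl, of d] by simp
    ultimately show False using z(2) by blast
  qed
  have "z +o D \<subseteq> sumset (3 * s + 2) D + D" using z(1) by (rule set_plus_mono3)
  then have "R (z +o D) \<union> R (sumset (3 * s) D) \<subseteq> R (sumset (3 * Suc s) D)"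
    using sumset_increasing[OF zero, of "3 * s" "3 * Suc s"] unfolding R_def
    by (auto simp: eval_nat_numeral)
  then have "card (R (z +o D) \<union> R (sumset (3 * s) D)) \<le> card (R (sumset (3 * Suc s) D))"
    unfolding R_def using finite_sumset[OF fin] by (intro card_mono) auto
  moreover have "finite (z +o D)" using fin by (simp add: elt_set_plus_def)
  ultimately have "card_mod m (z +o D) + card_mod m (sumset (3 * s) D)
      \<le> card_mod m (sumset (3 * Suc s) D)"
    using disjoint finite_sumset[OF fin] unfolding card_mod_def R_def
    by (simp add: card_Un_disjoint)
  then show ?case using Suc by (simp add: card_mod_elt_set_plus)
qed simp

lemma card_le_card_mod:
  assumes "0 < L" "S \<subseteq> {- L..L}"
  shows "card S \<le> 3 * card_mod L S"
proof -
  define R where "R = (\<lambda>x. x mod L) ` S"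
  have "finite R" unfolding R_def using finite_subset[OF assms(2)] by simp
  have "S \<subseteq> (\<lambda>(r, j). r + j * L) ` (R \<times> {- 1, 0, 1})"
  proof
    fix x assume x: "x \<in> S"
    have "- L \<le> x" "x \<le> L" using x assms(2) by auto
    then have "- L div L \<le> x div L" "x div L \<le> L div L" using assms(1) by (intro zdiv_mono1; simp)+
    moreover have "- L div L = - 1" "L div L = 1" using assms(1) by (simp_all add: dvd_neg_div)
    ultimately have "x div L \<in> {- 1, 0, 1}" by auto
    moreover have "x = x mod L + x div L * L" by simp
    ultimately show "x \<in> (\<lambda>(r, j). r + j * L) ` (R \<times> {- 1, 0, 1})"
      unfolding R_def using x by (intro image_eqI[of _ _ "(x mod L, x div L)"]) auto
  qed
  then have "card S \<le> card (R \<times> {- 1, 0, 1::int})" using \<open>finite R\<close> by (intro surj_card_le) auto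
  then show ?thesis unfolding card_mod_def R_def by (simp add: card_cartesian_product)
qed

locale symmetric_int_set =
  fixes D :: "int set" and L :: int
  assumes zero_mem: "0 \<in> D" and uminus_subset: "uminus ` D \<subseteq> D"
    and bound_mem: "L \<in> D" and bound_pos: "0 < L" and bounded: "D \<subseteq> {- L..L}"
begin

lemma finite: "finite D"
  using bounded finite_subset by blast

lemma int_times_bound_mem_sumset:
  assumes "\<bar>j\<bar> \<le> int n"
  shows "j * L \<in> sumset n D"
proof -
  have "- L \<in> D" using bound_mem uminus_subset by blast
  then have "int (nat \<bar>j\<bar>) * L \<in> sumset (nat \<bar>j\<bar>) D" "int (nat \<bar>j\<bar>) * (- L) \<in> sumset (nat \<bar>j\<bar>) D"
    using of_nat_mult_mem_sumset bound_mem by blast+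
  then have "j * L \<in> sumset (nat \<bar>j\<bar>) D" by (auto simp: abs_if split: if_splits)
  then show ?thesis using sumset_increasing[OF zero_mem, of "nat \<bar>j\<bar>" n] assms
    by (auto simp: nat_le_iff)
qed

lemma card_mod_le_card_sumset: "(k + 1) * card_mod L (sumset n D) \<le> card (sumset (n + k) D)"
proof -
  define R where "R = (\<lambda>x. x mod L) ` sumset n D"
  define rep where "rep = inv_into (sumset n D) (\<lambda>x. x mod L)"
  have rep: "rep r \<in> sumset n D" "rep r mod L = r" if "r \<in> R" for r
    using that unfolding R_def rep_def by (auto intro: inv_into_into f_inv_into_f)
  define F where "F = (\<lambda>(r, t). rep r + int t * L)"
  have "inj_on F (R \<times> {..k})"
  proof (rule inj_onI)
    fix u v assume uv: "u \<in> R \<times> {..k}" "v \<in> R \<times> {..k}" "F u = F v"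
    obtain r t r' t' where u: "u = (r, t)" and v: "v = (r', t')" by fastforce
    have eq: "rep r + int t * L = rep r' + int t' * L" using uv(3) unfolding u v F_def by simp
    then have "rep r mod L = rep r' mod L" by (metis mod_mult_self1)
    then have "r = r'" using rep(2) uv(1,2) unfolding u v by auto
    then show "u = v" using eq bound_pos unfolding u v by simp
  qed
  moreover have "F ` (R \<times> {..k}) \<subseteq> sumset (n + k) D"
    unfolding F_def sumset_add using rep(1) int_times_bound_mem_sumset by auto
  ultimately have "card (R \<times> {..k}) \<le> card (sumset (n + k) D)"
    using finite_sumset[OF finite] by (rule card_inj_on_le)
  then show ?thesis unfolding card_mod_def R_def by (simp add: card_cartesian_product mult.commute)
qed

lemma multiples_of_Gcd_subset_sumset_if_stable:
  assumes "[sumset (Suc n) D \<subseteq> sumset n D] (mod L)"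
  shows "{x \<in> {- L..L}. Gcd D dvd x} \<subseteq> sumset (2 * n + 1) D"
proof
  fix x assume x: "x \<in> {x \<in> {- L..L}. Gcd D dvd x}"
  then have "x \<in> group_closure D" unfolding group_closure_eq by (auto elim: dvdE)
  then obtain k where "x \<in> sumset k D" using group_closure_subset_sumsets[OF uminus_subset] by blast
  then obtain w where w: "w \<in> sumset n D" "[x = w] (mod L)"
    using cong_subset_sumset_stable[OF zero_mem assms] by (auto elim: cong_subsetE)
  then obtain j where j: "x = w + j * L" by (metis cong_iff_lin cong_sym mult.commute)
  have "sumset n D \<subseteq> {- (int n * L)..int n * L}"
    using sumset_mono[OF bounded] sumset_atLeastAtMost_subset by (rule subset_trans)
  then have "\<bar>j * L\<bar> \<le> (int n + 1) * L" using w(1) x j by (fastforce simp: algebra_simps)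
  then have "\<bar>j\<bar> \<le> int (n + 1)" using bound_pos by (simp add: abs_mult)
  then have "x \<in> sumset n D + sumset (n + 1) D"
    unfolding j using w(1) int_times_bound_mem_sumset by blast
  then have "x \<in> sumset (n + (n + 1)) D" unfolding sumset_add[of n "n + 1"] .
  then show "x \<in> sumset (2 * n + 1) D" by (simp add: mult_2)
qed

text \<open>
  Modulo \<open>L\<close> the sets \<open>sumset n D\<close> either become stationary before \<open>n = 3 s\<close>, or gain at least the
  size of \<open>D\<close> every three steps. Adding \<open>0, L, \<dots>, k L\<close> multiplies the size over the integers by
  \<open>k + 1\<close>.
\<close>

theorem sumset_growth_dichotomy:
  "s * (k + 1) * card D \<le> 3 * card (sumset (3 * s + k) D) \<or>
    {x \<in> {- L..L}. Gcd D dvd x} \<subseteq> sumset (6 * s) D"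
proof (cases "\<exists>n<3 * s. [sumset (Suc n) D \<subseteq> sumset n D] (mod L)")
  case True
  then obtain n where "n < 3 * s" "[sumset (Suc n) D \<subseteq> sumset n D] (mod L)" by blast
  then show ?thesis
    using multiples_of_Gcd_subset_sumset_if_stable
      sumset_increasing[OF zero_mem, of "2 * n + 1" "6 * s"]
    by fastforce
next
  case False
  have "s * (k + 1) * card D \<le> s * (k + 1) * (3 * card_mod L D)"
    using card_le_card_mod[OF bound_pos bounded] by (rule mult_left_mono) simp
  also have "\<dots> = 3 * ((k + 1) * (s * card_mod L D))" by (simp only: mult_ac)
  also have "\<dots> \<le> 3 * ((k + 1) * card_mod L (sumset (3 * s) D))"
    using card_mod_sumset_growth[OF finite zero_mem uminus_subset] False
    by (intro mult_left_mono) auto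
  also have "\<dots> \<le> 3 * card (sumset (3 * s + k) D)"
    using card_mod_le_card_sumset by (rule mult_left_mono) simp
  finally show ?thesis by blast
qed

end

section \<open>Each factor fills a progression\<close>

definition fills_progression :: "int \<Rightarrow> nat \<Rightarrow> int set \<Rightarrow> int \<Rightarrow> int \<Rightarrow> bool" where
  "fills_progression m K S u l \<longleftrightarrow> 0 < l \<and> coprime u m \<and>
     [S \<subseteq> u *o {- l..l}] (mod m) \<and> [u *o {- l..l} \<subseteq> sumset K S] (mod m)"

lemma card_sumset_small_reps_le:
  assumes m: "0 < m" and inv: "[b * c = 1] (mod m)" and B: "inj_on (\<lambda>x. x mod m) B"
    and small: "[S * B \<subseteq> {- N..N}] (mod m)" "8 * (int n * N) \<le> m"
  shows "int (card (sumset n (small_reps m N (b *o S))) * card B) \<le> 2 * m"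
proof -
  define X where "X = sumset n (small_reps m N (b *o S))"
  have "X \<subseteq> {- (int n * N)..int n * N}"
    unfolding X_def using sumset_mono[OF small_reps_subset] sumset_atLeastAtMost_subset
    by (rule subset_trans)
  then have inj_X: "inj_on (\<lambda>x. x mod m) X"
    using small(2) m by (intro inj_on_mod_if_bounded[of X "int n * N"]) auto
  have "coprime c m" using inv by (intro coprime_if_cong_mult_1[of c b]) (simp add: mult.commute)
  then have inj_cB: "inj_on (\<lambda>x. x mod m) (c *o B)" and card_cB: "card (c *o B) = card B"
    using B by (simp_all add: inj_on_mod_elt_set_times card_elt_set_times_if_coprime)
  have "[X \<subseteq> b *o sumset n S] (mod m)"
    unfolding X_def sumset_elt_set_times[symmetric]
    by (intro cong_subset_sumset small_reps_cong_subset)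
  then have "[X * (c *o B) \<subseteq> (b *o sumset n S) * (c *o B)] (mod m)"
    by (intro cong_subset_times cong_subset_refl)
  also have "(b *o sumset n S) * (c *o B) = (b * c) *o (sumset n S * B)"
    by (rule set_times_rearrange)
  also have "[(b * c) *o (sumset n S * B) \<subseteq> sumset n S * B] (mod m)"
    using inv by (rule cong_subset_elt_set_times_if_cong_1)
  also have "[sumset n S * B \<subseteq> {- (int n * N)..int n * N}] (mod m)"
    using small(1) by (rule cong_subset_sumset_times)
  finally have "int (card X * card (c *o B)) \<le> 2 * m"
    by (rule card_times_card_le_if_products_small[OF m inj_X inj_cB _ small(2)])
  then show ?thesis unfolding X_def card_cB .
qed

lemma card_le_card_small_reps:
  assumes "T \<subseteq> S" "inj_on (\<lambda>x. x mod m) T" "coprime b m" "[b *o S \<subseteq> {- N..N}] (mod m)"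
  shows "card T \<le> card (small_reps m N (b *o S))"
proof -
  have "b *o T \<subseteq> b *o S" using assms(1) by (rule set_times_mono)
  also have "[b *o S \<subseteq> small_reps m N (b *o S)] (mod m)"
    using assms(4) by (rule cong_subset_small_reps)
  finally have "card (b *o T) \<le> card (small_reps m N (b *o S))"
    using inj_on_mod_elt_set_times[OF assms(2,3)] finite_small_reps by (rule card_le_if_cong_subset)
  then show ?thesis by (simp add: card_elt_set_times_if_coprime[OF assms(2,3)])
qed

lemma card_le_card_small_reps_diff_set:
  assumes "inj_on (\<lambda>x. x mod m) A" "coprime b m" "[b *o diff_set A \<subseteq> {- N..N}] (mod m)"
  shows "card A \<le> card (small_reps m N (b *o diff_set A))"
proof (cases "A = {}")
  case False
  then obtain a where "a \<in> A" by blast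
  then have "(\<lambda>x. x - a) ` A \<subseteq> diff_set A" unfolding diff_set_def by blast
  moreover have "inj_on (\<lambda>x. x mod m) ((\<lambda>x. x - a) ` A)"
    using assms(1) by (auto simp: inj_on_def cong_iff_dvd_diff simp flip: cong_def)
  ultimately have "card ((\<lambda>x. x - a) ` A) \<le> card (small_reps m N (b *o diff_set A))"
    using assms(2,3) by (rule card_le_card_small_reps)
  then show ?thesis by (simp add: card_image inj_on_diff_left)
qed simp

lemma symmetric_int_set_small_reps:
  assumes S: "0 \<in> S" "uminus ` S \<subseteq> S" and card: "2 \<le> card (small_reps m M S)"
  obtains L where "symmetric_int_set (small_reps m M S) L" "L \<le> M"
proof -
  define D where "D = small_reps m M S"
  have fin: "finite D" unfolding D_def by (rule finite_small_reps)
  have "D \<noteq> {}" using card unfolding D_def by auto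
  then have "0 \<le> M" using small_reps_subset[of m M S] unfolding D_def by fastforce
  then have zero: "0 \<in> D" unfolding D_def small_reps_def using S(1) by (auto intro: bexI[of _ 0])
  have sym: "uminus ` D \<subseteq> D"
    using S(2) unfolding D_def small_reps_def
    by (auto simp: minus_le_iff) (metis cong_uminus image_subset_iff)
  have max: "x \<le> Max D" "- Max D \<le> x" if "x \<in> D" for x
    using Max_ge[OF fin, of x] Max_ge[OF fin, of "- x"] that sym by auto
  have "0 < Max D"
  proof (rule ccontr)
    assume "\<not> 0 < Max D"
    then have "D \<subseteq> {0}" using max by fastforce
    then have "card D \<le> 1" using card_mono[of "{0}" D] by simp
    then show False using card unfolding D_def by simp
  qed
  then have "symmetric_int_set D (Max D)"
    using zero sym max fin by unfold_locales (auto intro: Max_in)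
  moreover have "Max D \<in> {- M..M}"
    using Max_in[OF fin \<open>D \<noteq> {}\<close>] small_reps_subset unfolding D_def by blast
  ultimately show thesis using that unfolding D_def by simp
qed

lemma multiples_in_interval_eq:
  fixes g l :: int
  assumes "0 < g"
  shows "{x \<in> {- (g * l)..g * l}. g dvd x} = g *o {- l..l}"
proof -
  have "g * i \<in> {- (g * l)..g * l} \<longleftrightarrow> i \<in> {- l..l}" for i
    using mult_le_cancel_left_pos[OF assms, of "- l" i] mult_le_cancel_left_pos[OF assms, of i l]
    by simp
  then show ?thesis unfolding elt_set_times_def dvd_def by blast
qed

lemma fills_progression_if_scaled:
  assumes inv: "[c * b = 1] (mod m)" and g: "coprime g m" and l: "0 < l"
    and cong: "[b *o S \<subseteq> D] (mod m)" "[D \<subseteq> b *o S] (mod m)"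
    and fills: "D \<subseteq> g *o {- l..l}" "g *o {- l..l} \<subseteq> sumset K D"
  shows "fills_progression m K S (c * g) l"
  unfolding fills_progression_def
proof (intro conjI)
  show "0 < l" by (rule l)
  show "coprime (c * g) m" using coprime_if_cong_mult_1[OF inv] g by simp
  have "[S \<subseteq> c *o (b *o S)] (mod m)"
    unfolding set_times_rearrange2 using inv by (rule cong_subset_elt_set_times_if_cong_1)
  also have "[c *o (b *o S) \<subseteq> c *o D] (mod m)"
    using cong(1) by (simp add: cong_subset_elt_set_times)
  also have "c *o D \<subseteq> c *o (g *o {- l..l})" using fills(1) by (rule set_times_mono)
  finally show "[S \<subseteq> (c * g) *o {- l..l}] (mod m)" unfolding set_times_rearrange2 .
  have "c *o (g *o {- l..l}) \<subseteq> c *o sumset K D" using fills(2) by (rule set_times_mono)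
  also have "[c *o sumset K D \<subseteq> c *o sumset K (b *o S)] (mod m)"
    using cong(2) by (simp add: cong_subset_elt_set_times cong_subset_sumset)
  also have "c *o sumset K (b *o S) = (c * b) *o sumset K S"
    unfolding sumset_elt_set_times set_times_rearrange2 ..
  also have "[(c * b) *o sumset K S \<subseteq> sumset K S] (mod m)"
    using inv by (rule cong_subset_elt_set_times_if_cong_1)
  finally show "[(c * g) *o {- l..l} \<subseteq> sumset K S] (mod m)" unfolding set_times_rearrange2 .
qed

lemma fills_progression_if_Gcd_multiples:
  assumes m: "prime m" and inv: "[c * b = 1] (mod m)" and D: "symmetric_int_set D L" "L < m"
    and cong: "[b *o S \<subseteq> D] (mod m)" "[D \<subseteq> b *o S] (mod m)"
    and multiples: "{x \<in> {- L..L}. Gcd D dvd x} \<subseteq> sumset K D"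
  obtains u l where "fills_progression m K S u l" "int (card D) \<le> 2 * l + 1"
proof -
  interpret symmetric_int_set D L by (rule D)
  define g where "g = Gcd D"
  have "g dvd L" unfolding g_def using bound_mem by (rule Gcd_dvd)
  then obtain l where l: "L = g * l" ..
  have "0 \<le> g" unfolding g_def by simp
  then have g: "0 < g" and l_pos: "0 < l" using l bound_pos by (auto simp: zero_less_mult_iff)
  have eq: "{x \<in> {- L..L}. Gcd D dvd x} = g *o {- l..l}"
    using multiples_in_interval_eq[OF g] unfolding l g_def .
  have "D \<subseteq> {x \<in> {- L..L}. Gcd D dvd x}" using bounded by auto
  then have D_sub: "D \<subseteq> g *o {- l..l}" unfolding eq .
  have "g < m" using \<open>g dvd L\<close> D(2) bound_pos zdvd_imp_le by fastforce
  then have "coprime g m" using coprime_if_residue[OF m, of g] g by simp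
  then have "fills_progression m K S (c * g) l"
    using fills_progression_if_scaled[OF inv _ l_pos cong D_sub] multiples unfolding eq by blast
  moreover have "D \<subseteq> (*) g ` {- l..l}" using D_sub unfolding elt_set_times_def by auto
  then have "card D \<le> card {- l..l}" by (rule surj_card_le[rotated]) simp
  then have "int (card D) \<le> 2 * l + 1" using l_pos by simp
  ultimately show thesis using that by blast
qed

lemma obtain_nat_quotient:
  fixes m d :: int
  assumes "0 < d" "0 \<le> m"
  obtains k :: nat where "int k * d \<le> m" "m < (int k + 1) * d"
proof
  have "0 \<le> m div d" using assms by (simp add: pos_imp_zdiv_nonneg_iff)
  then have "int (nat (m div d)) * d = m - m mod d" by (simp add: minus_mod_eq_div_mult)
  moreover have "0 \<le> m mod d" "m mod d < d" using assms(1) by simp_all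
  ultimately show "int (nat (m div d)) * d \<le> m" "m < (int (nat (m div d)) + 1) * d"
    by (simp_all add: distrib_right)
qed

text \<open>For \<open>k \<approx> m / (16 N)\<close> faster growth would violate \<open>card_sumset_small_reps_le\<close>.\<close>

lemma sumset_small_reps_grows_slowly:
  assumes m: "0 < m" and inv: "[b * c = 1] (mod m)" and B: "inj_on (\<lambda>x. x mod m) B"
    and small: "[S * B \<subseteq> {- N..N}] (mod m)" and s: "192 \<le> s"
    and N: "0 < N" "N \<le> 2 * int (card (small_reps m N (b *o S)) * card B)" "48 * (int s * N) \<le> m"
  shows "\<exists>k. 3 * card (sumset (3 * s + k) (small_reps m N (b *o S)))
    < s * (k + 1) * card (small_reps m N (b *o S))"
proof -
  define D where "D = small_reps m N (b *o S)"
  obtain k :: nat where k: "int k * (16 * N) \<le> m" "m < (int k + 1) * (16 * N)"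
    using obtain_nat_quotient[of "16 * N" m] m N(1) by auto
  have "\<not> s * (k + 1) * card D \<le> 3 * card (sumset (3 * s + k) D)"
  proof
    assume "s * (k + 1) * card D \<le> 3 * card (sumset (3 * s + k) D)"
    then have "s * (k + 1) * card D * card B \<le> 3 * card (sumset (3 * s + k) D) * card B"
      by (rule mult_right_mono) simp
    moreover have "192 * ((k + 1) * (card D * card B)) \<le> s * ((k + 1) * (card D * card B))"
      using s by (rule mult_right_mono) simp
    ultimately have "192 * ((k + 1) * (card D * card B))
        \<le> 3 * (card (sumset (3 * s + k) D) * card B)"
      by (simp only: mult.assoc)
    then have "96 * ((int k + 1) * (2 * int (card D * card B)))
        \<le> 3 * int (card (sumset (3 * s + k) D) * card B)"
      unfolding of_nat_le_iff[symmetric, where 'a = int] by (simp add: algebra_simps)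
    moreover have "8 * (int (3 * s + k) * N) \<le> m" using k(1) N(3) by (simp add: algebra_simps)
    then have "int (card (sumset (3 * s + k) D) * card B) \<le> 2 * m"
      unfolding D_def by (rule card_sumset_small_reps_le[OF m inv B small])
    ultimately have "96 * ((int k + 1) * (2 * int (card D * card B))) \<le> 6 * m"
      by linarith
    moreover have "(int k + 1) * N \<le> (int k + 1) * (2 * int (card D * card B))"
      using N(2) unfolding D_def by (rule mult_left_mono) simp
    moreover have "m < 16 * ((int k + 1) * N)" using k(2) by (simp add: mult_ac)
    ultimately show False by linarith
  qed
  then show ?thesis unfolding D_def not_le by blast
qed

theorem diff_set_fills_progression:
  assumes m: "prime m" and A: "inj_on (\<lambda>x. x mod m) A" "2 \<le> card A"
    and B: "inj_on (\<lambda>x. x mod m) B" "b \<in> B" "coprime b m"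
    and small: "[diff_set A * B \<subseteq> {- N..N}] (mod m)"
    and s: "192 \<le> s" and N: "N \<le> 2 * int (card A * card B)" "48 * (int s * N) \<le> m"
  obtains u l where "fills_progression m (6 * s) (diff_set A) u l" "int (card A) \<le> 2 * l + 1"
proof -
  have m_pos: "0 < m" using m by (simp add: prime_gt_0_int)
  obtain c where inv: "[b * c = 1] (mod m)" using cong_solve_coprime_int[OF B(3)] by blast
  define D where "D = small_reps m N (b *o diff_set A)"
  have "[b *o diff_set A \<subseteq> {- N..N}] (mod m)"
    using subset_cong_subset_trans[OF set_times_mono4[OF B(2)] small] .
  then have cong: "[b *o diff_set A \<subseteq> D] (mod m)" "[D \<subseteq> b *o diff_set A] (mod m)"
    and card: "card A \<le> card D"
    unfolding D_def using A(1) B(3)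
    by (simp_all add: cong_subset_small_reps small_reps_cong_subset
        card_le_card_small_reps_diff_set)
  have "A \<noteq> {}" using A(2) by auto
  obtain L where L: "symmetric_int_set D L" "L \<le> N"
    unfolding D_def
  proof (rule symmetric_int_set_small_reps)
    show "0 \<in> b *o diff_set A" "uminus ` (b *o diff_set A) \<subseteq> b *o diff_set A"
      using zero_mem_diff_set[OF \<open>A \<noteq> {}\<close>] uminus_diff_set_subset[of A]
      by (auto simp: elt_set_times_def image_subset_iff simp flip: mult_minus_right)
    show "2 \<le> card (small_reps m N (b *o diff_set A))" using card A(2) unfolding D_def by linarith
  qed
  interpret symmetric_int_set D L by (rule L)
  have "0 < N" using L(2) bound_pos by simp
  then have "N \<le> int s * N" using s by simp
  then have "L < m" using L(2) \<open>0 < N\<close> N(2) by linarith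
  have "N \<le> 2 * int (card D * card B)"
    using N(1) mult_right_mono[OF card, of "card B"] by linarith
  then obtain k where "3 * card (sumset (3 * s + k) D) < s * (k + 1) * card D"
    using sumset_small_reps_grows_slowly[OF m_pos inv B(1) small s \<open>0 < N\<close> _ N(2)]
    unfolding D_def by blast
  then have "{x \<in> {- L..L}. Gcd D dvd x} \<subseteq> sumset (6 * s) D"
    using sumset_growth_dichotomy[of s k] by auto
  moreover have "[c * b = 1] (mod m)" using inv by (simp add: mult.commute)
  ultimately obtain u l where "fills_progression m (6 * s) (diff_set A) u l"
    and "int (card D) \<le> 2 * l + 1"
    using fills_progression_if_Gcd_multiples[OF m _ L(1) \<open>L < m\<close> cong] by blast
  then show thesis using card that by force
qed

lemma fills_progression_times:
  assumes "fills_progression m K S u l" "[S * T \<subseteq> {- N..N}] (mod m)"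
  shows "[(u *o {- l..l}) * T \<subseteq> {- (int K * N)..int K * N}] (mod m)"
proof -
  have "[u *o {- l..l} \<subseteq> sumset K S] (mod m)"
    using assms(1) unfolding fills_progression_def by blast
  then have "[(u *o {- l..l}) * T \<subseteq> sumset K S * T] (mod m)"
    by (intro cong_subset_times cong_subset_refl)
  also have "[sumset K S * T \<subseteq> {- (int K * N)..int K * N}] (mod m)"
    using assms(2) by (rule cong_subset_sumset_times)
  finally show ?thesis .
qed

lemma fills_progression_elt_times:
  assumes fills: "fills_progression m K S u l" and small: "[S * T \<subseteq> {- N..N}] (mod m)"
    and m: "3 * (int K * N) < m"
  shows "[u *o T \<subseteq> {- (int K * N div l)..int K * N div l}] (mod m)"
  unfolding cong_subset_def
proof
  fix z assume "z \<in> u *o T"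
  then obtain t where t: "t \<in> T" "z = u * t" unfolding elt_set_times_def by blast
  have l: "0 < l" using fills unfolding fills_progression_def by blast
  have "z *o {- l..l} = t *o (u *o {- l..l})"
    unfolding set_times_rearrange2 t(2) mult.commute[of u] ..
  also have "\<dots> \<subseteq> (u *o {- l..l}) * T" using t(1) by (rule set_times_mono4)
  also have "[(u *o {- l..l}) * T \<subseteq> {- (int K * N)..int K * N}] (mod m)"
    using fills small by (rule fills_progression_times)
  finally obtain y where y: "[z = y] (mod m)" "\<bar>y\<bar> * l \<le> int K * N"
    by (rule small_if_multiples_small[OF l m])
  have "\<bar>y\<bar> \<le> int K * N div l" using zdiv_mono1[OF y(2) l] l by simp
  then show "\<exists>y\<in>{- (int K * N div l)..int K * N div l}. [z = y] (mod m)"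
    using y(1) by (intro bexI[of _ y]) auto
qed

lemma fills_progression_steps_product:
  assumes S: "fills_progression m K S u l" and T: "fills_progression m K T v l'"
    and small: "[S * T \<subseteq> {- N..N}] (mod m)" and m: "3 * (int K * (int K * N)) < m" and N: "0 \<le> N"
  obtains g where "[u * v = g] (mod m)" "\<bar>g\<bar> * (l * l') \<le> int K * (int K * N)"
proof -
  define M where "M = int K * (int K * N)"
  have l: "0 < l" "0 < l'" using S T unfolding fills_progression_def by blast+
  have "[T * S \<subseteq> {- N..N}] (mod m)" using small by (simp add: mult.commute)
  then have "[(v *o {- l'..l'}) * S \<subseteq> {- (int K * N)..int K * N}] (mod m)"
    by (rule fills_progression_times[OF T])
  then have "[u *o (v *o {- l'..l'}) \<subseteq> {- (M div l)..M div l}] (mod m)"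
    unfolding M_def using fills_progression_elt_times[OF S _ m] by (simp add: mult.commute)
  then have multiples: "[(u * v) *o {- l'..l'} \<subseteq> {- (M div l)..M div l}] (mod m)"
    unfolding set_times_rearrange2 .
  have "0 \<le> M" unfolding M_def using N by simp
  then have "M div l \<le> M" using zdiv_mono2[of M 1 l] l(1) by simp
  then have "3 * (M div l) < m" using m unfolding M_def by linarith
  then obtain g where g: "[u * v = g] (mod m)" "\<bar>g\<bar> * l' \<le> M div l"
    using small_if_multiples_small[OF l(2) _ multiples] by blast
  have "\<bar>g\<bar> * l' * l \<le> M div l * l" using g(2) l(1) by (intro mult_right_mono) auto
  also have "\<dots> \<le> M" using minus_mod_eq_div_mult[of M l] pos_mod_sign[OF l(1), of M] by linarith
  finally show thesis using that g(1) unfolding M_def by (simp add: mult_ac)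
qed

lemma fills_progression_uminus: "fills_progression m K S (- u) l \<longleftrightarrow> fills_progression m K S u l"
proof -
  have "(- u) *o {- l..l} = u *o {- l..l}"
    unfolding elt_set_times_def by (force intro: bexI[of _ "- _"])
  then show ?thesis unfolding fills_progression_def by simp
qed

lemma fills_progression_positive_steps_product:
  assumes S: "fills_progression m K S u l" and T: "fills_progression m K T v l'" and "1 < m"
    and small: "[S * T \<subseteq> {- N..N}] (mod m)" "3 * (int K * (int K * N)) < m" "0 \<le> N"
  obtains w g where "fills_progression m K T w l'" "[u * w = g] (mod m)" "0 < g"
    and "g * (l * l') \<le> int K * (int K * N)"
proof -
  obtain g where g: "[u * v = g] (mod m)" "\<bar>g\<bar> * (l * l') \<le> int K * (int K * N)"
    using fills_progression_steps_product[OF S T small] .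
  have "coprime (u * v) m" using S T unfolding fills_progression_def by simp
  then have "coprime g m" using cong_imp_coprime[OF g(1)] by simp
  then have "g \<noteq> 0" using \<open>1 < m\<close> by auto
  show thesis
  proof (cases "0 < g")
    case True
    then show thesis using that[OF T g(1)] g(2) by simp
  next
    case False
    then have "0 < - g" using \<open>g \<noteq> 0\<close> by simp
    moreover have "fills_progression m K T (- v) l'" using T by (simp add: fills_progression_uminus)
    moreover have "[u * - v = - g] (mod m)" using cong_uminus[OF g(1)] by simp
    ultimately show thesis using that[of "- v" "- g"] g(2) by simp
  qed
qed

lemma cong_subset_diff_set_times_diff_set:
  assumes "[diff_set A * B \<subseteq> {- N..N}] (mod m)"
  shows "[diff_set A * diff_set B \<subseteq> {- (2 * N)..2 * N}] (mod m)"
proof -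
  have "diff_set A * diff_set B \<subseteq> diff_set (diff_set A * B)"
    using diff_set_times_subset[of B "diff_set A"] by (simp add: mult.commute)
  also have "[diff_set (diff_set A * B) \<subseteq> diff_set {- N..N}] (mod m)"
    using assms by (rule cong_subset_diff_set)
  also have "diff_set {- N..N} \<subseteq> {- (2 * N)..2 * N}" by (rule diff_set_bounded) simp
  finally show ?thesis .
qed

theorem factors_fill_progressions:
  assumes m: "prime m"
    and A: "A \<subseteq> {0<..<m}" "2 \<le> card A" and B: "B \<subseteq> {0<..<m}" "2 \<le> card B"
    and small: "[diff_set (A * B) \<subseteq> {- N..N}] (mod m)" and K: "K = 6 * s" "192 \<le> s"
    and N: "0 < N" "N \<le> 2 * int (card A * card B)" "6 * (int K * (int K * N)) < m"
  obtains u l v l' g where "fills_progression m K (diff_set A) u l"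
    and "fills_progression m K (diff_set B) v l'"
    and "[u *o B \<subseteq> {- (int K * N div l)..int K * N div l}] (mod m)"
    and "[v *o A \<subseteq> {- (int K * N div l')..int K * N div l'}] (mod m)"
    and "[u * v = g] (mod m)" "0 < g"
    and "N \<le> 18 * (l * l')" "g * (l * l') \<le> 2 * (int K * (int K * N))"
proof -
  have inj: "inj_on (\<lambda>x. x mod m) A" "inj_on (\<lambda>x. x mod m) B"
    using A(1) B(1) by (simp_all add: inj_on_mod_if_residues)
  obtain a b where ab: "a \<in> A" "b \<in> B" using A(2) B(2) by fastforce
  then have coprime: "coprime a m" "coprime b m" using coprime_if_residue[OF m] A(1) B(1) by blast+
  have small_A: "[diff_set A * B \<subseteq> {- N..N}] (mod m)"
    using diff_set_times_subset small by (rule subset_cong_subset_trans)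
  have small_B: "[diff_set B * A \<subseteq> {- N..N}] (mod m)"
    using diff_set_times_subset small unfolding mult.commute[of A B]
    by (rule subset_cong_subset_trans)
  have "192 * (int s * N) \<le> int s * (int s * N)" using K(2) N(1) by (intro mult_right_mono) auto
  moreover have "216 * (int s * (int s * N)) < m" "int K * N = 6 * (int s * N)"
    using N(3) K(1) by simp_all
  moreover have "0 \<le> int s * N" using N(1) by simp
  ultimately have s_small: "48 * (int s * N) \<le> m" and K_small: "3 * (int K * N) < m" by linarith+
  have K2_small: "3 * (int K * (int K * (2 * N))) < m" using N(3) by simp
  obtain u l where u: "fills_progression m K (diff_set A) u l" and l: "int (card A) \<le> 2 * l + 1"
    unfolding K(1)
    by (rule diff_set_fills_progression[OF m inj(1) A(2) inj(2) ab(2) coprime(2) small_A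
          K(2) N(2) s_small])
  have "N \<le> 2 * int (card B * card A)" using N(2) by (simp add: mult.commute)
  then obtain v' l' where v': "fills_progression m K (diff_set B) v' l'"
    and l': "int (card B) \<le> 2 * l' + 1"
    unfolding K(1)
    by (rule diff_set_fills_progression[OF m inj(2) B(2) inj(1) ab(1) coprime(1) small_B
          K(2) _ s_small])
  obtain v g where v: "fills_progression m K (diff_set B) v l'"
    and g: "[u * v = g] (mod m)" "0 < g" "g * (l * l') \<le> int K * (int K * (2 * N))"
    using fills_progression_positive_steps_product[OF u v' prime_gt_1_int[OF m]
        cong_subset_diff_set_times_diff_set[OF small_A] K2_small] N(1) by auto
  have "0 < l" "0 < l'" using u v unfolding fills_progression_def by blast+
  then have "int (card A) * int (card B) \<le> (3 * l) * (3 * l')" using l l' by (intro mult_mono) auto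
  then have "N \<le> 18 * (l * l')" using N(2) by simp
  moreover have "g * (l * l') \<le> 2 * (int K * (int K * N))" using g(3) by (simp add: mult_ac)
  ultimately show thesis
    using that[OF u v] fills_progression_elt_times[OF u small_A K_small]
      fills_progression_elt_times[OF v small_B K_small] g(1,2) by blast
qed

section \<open>Lifting the factorization to the integers\<close>

lemma diff_set_small_reps_subset:
  assumes A: "[diff_set A \<subseteq> u *o {- l..l}] (mod m)" and g: "[v * u = g] (mod m)" "0 \<le> g"
    and m: "2 * M + g * l < m"
  shows "diff_set (small_reps m M (v *o A)) \<subseteq> g *o {- l..l}"
proof (rule cong_subset_imp_subset[OF _ _ _ m])
  have "[diff_set (small_reps m M (v *o A)) \<subseteq> diff_set (v *o A)] (mod m)"
    by (intro cong_subset_diff_set small_reps_cong_subset)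
  also have "diff_set (v *o A) \<subseteq> v *o diff_set A" by (rule diff_set_elt_set_times_subset)
  also have "[v *o diff_set A \<subseteq> v *o (u *o {- l..l})] (mod m)"
    using A by (simp add: cong_subset_elt_set_times)
  also have "v *o (u *o {- l..l}) = (v * u) *o {- l..l}" by (rule set_times_rearrange2)
  also have "[(v * u) *o {- l..l} \<subseteq> g *o {- l..l}] (mod m)"
    using g(1) by (simp add: cong_subset_elt_set_times)
  finally show "[diff_set (small_reps m M (v *o A)) \<subseteq> g *o {- l..l}] (mod m)" .
  show "diff_set (small_reps m M (v *o A)) \<subseteq> {- (2 * M)..2 * M}"
    by (intro diff_set_bounded small_reps_subset)
  show "g *o {- l..l} \<subseteq> {- (g * l)..g * l}"
    using g(2) mult_left_mono[of _ l g] mult_left_mono[of "- l" _ g]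
    by (auto simp: elt_set_times_def)
qed

lemma small_reps_times_cong:
  assumes "[v *o A \<subseteq> {- M..M}] (mod m)" "[u *o B \<subseteq> {- M'..M'}] (mod m)" "[u * v = g] (mod m)"
  shows "[small_reps m M (v *o A) * small_reps m M' (u *o B) \<subseteq> g *o (A * B)] (mod m)"
    and "[g *o (A * B) \<subseteq> small_reps m M (v *o A) * small_reps m M' (u *o B)] (mod m)"
proof -
  have eq: "(v *o A) * (u *o B) = (u * v) *o (A * B)"
    by (simp add: set_times_rearrange mult.commute)
  have "[small_reps m M (v *o A) * small_reps m M' (u *o B) \<subseteq> (u * v) *o (A * B)] (mod m)"
    unfolding eq[symmetric] by (intro cong_subset_times small_reps_cong_subset)
  also have "[(u * v) *o (A * B) \<subseteq> g *o (A * B)] (mod m)"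
    using assms(3) by (simp add: cong_subset_elt_set_times)
  finally show "[small_reps m M (v *o A) * small_reps m M' (u *o B) \<subseteq> g *o (A * B)] (mod m)" .
  have "[g *o (A * B) \<subseteq> (u * v) *o (A * B)] (mod m)"
    using cong_sym[OF assms(3)] by (simp add: cong_subset_elt_set_times)
  also have "[(u * v) *o (A * B) \<subseteq> small_reps m M (v *o A) * small_reps m M' (u *o B)] (mod m)"
    unfolding eq[symmetric] using assms(1,2) by (intro cong_subset_times cong_subset_small_reps)
  finally show "[g *o (A * B) \<subseteq> small_reps m M (v *o A) * small_reps m M' (u *o B)] (mod m)" .
qed

lemma small_reps_times_subset:
  "small_reps m M S * small_reps m M' T \<subseteq> {- (M * M')..M * M'}"
proof
  fix z assume "z \<in> small_reps m M S * small_reps m M' T"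
  then obtain x y where z: "z = x * y" "x \<in> small_reps m M S" "y \<in> small_reps m M' T"
    by (rule set_times_elim)
  then have "\<bar>x\<bar> \<le> M" "\<bar>y\<bar> \<le> M'" unfolding small_reps_def by auto
  then have "\<bar>z\<bar> \<le> M * M'" unfolding z(1) abs_mult by (intro mult_mono) auto
  then show "z \<in> {- (M * M')..M * M'}" by auto
qed

lemma scaled_progression_term:
  fixes g n n' m :: int
  assumes "[n' = g * n] (mod m)"
  shows "[g * (n + int i) = n' + g * int i] (mod m)"
    and "coprime g m \<Longrightarrow> m dvd n' + g * int i \<longleftrightarrow> m dvd n + int i"
proof -
  show cong: "[g * (n + int i) = n' + g * int i] (mod m)"
    using cong_add[OF cong_sym[OF assms] cong_refl, of "g * int i"] by (simp add: algebra_simps)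
  show "m dvd n' + g * int i \<longleftrightarrow> m dvd n + int i" if "coprime g m"
    using cong_dvd_iff[OF cong] coprime_dvd_mult_right_iff[of m g "n + int i"] that
    by (simp add: coprime_commute)
qed

lemma progression_cong_scaled:
  assumes X: "(\<lambda>x. x mod m) ` X = (\<lambda>x. x mod m) ` progression n 1 N - {0}"
    and g: "coprime g m" and n': "[n' = g * n] (mod m)"
    and bounded: "progression n' g N \<subseteq> {- M..M}" "M < m"
  shows "[g *o X \<subseteq> progression n' g N - {0}] (mod m)" "[progression n' g N - {0} \<subseteq> g *o X] (mod m)"
proof -
  note shift = scaled_progression_term(1)[OF n'] and dvd_iff = scaled_progression_term(2)[OF n' g]
  show "[g *o X \<subseteq> progression n' g N - {0}] (mod m)"
    unfolding cong_subset_def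
  proof
    fix z assume "z \<in> g *o X"
    then obtain x where x: "x \<in> X" "z = g * x" unfolding elt_set_times_def by blast
    then have "x mod m \<in> (\<lambda>x. x mod m) ` progression n 1 N - {0}" unfolding X[symmetric] by simp
    then obtain i where i: "i \<in> {1..N}" "[x = n + int i] (mod m)" "x mod m \<noteq> 0"
      unfolding progression_def cong_def by auto
    then have "\<not> m dvd n + int i" using cong_dvd_iff[OF i(2)] by (simp add: dvd_eq_mod_eq_0)
    then have "n' + g * int i \<noteq> 0" using dvd_iff[of i] by auto
    then have "n' + g * int i \<in> progression n' g N - {0}"
      using i(1) unfolding progression_def by blast
    moreover have "[z = n' + g * int i] (mod m)"
      unfolding x(2) using cong_trans[OF cong_scalar_left[OF i(2)] shift] .
    ultimately show "\<exists>t\<in>progression n' g N - {0}. [z = t] (mod m)" by blast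
  qed
  show "[progression n' g N - {0} \<subseteq> g *o X] (mod m)"
    unfolding cong_subset_def
  proof
    fix z assume z: "z \<in> progression n' g N - {0}"
    then obtain i where i: "i \<in> {1..N}" "z = n' + g * int i" unfolding progression_def by auto
    have "\<bar>z\<bar> < m" using z bounded by fastforce
    then have "\<not> m dvd z" using z dvd_imp_le_int[of z m] by fastforce
    then have "(n + int i) mod m \<noteq> 0" using dvd_iff[of i] i(2) by (simp add: mod_eq_0_iff_dvd)
    then have "(n + int i) mod m \<in> (\<lambda>x. x mod m) ` progression n 1 N - {0}"
      using i(1) unfolding progression_def by auto
    then obtain x where "x \<in> X" "[n + int i = x] (mod m)" unfolding X[symmetric] cong_def by auto
    then show "\<exists>t\<in>g *o X. [z = t] (mod m)"
      unfolding i(2) using cong_trans[OF cong_sym[OF shift] cong_scalar_left] by blast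
  qed
qed

lemma small_reps_times_eq_progression:
  assumes product: "(\<lambda>x. x mod m) ` (A * B) = (\<lambda>x. x mod m) ` progression n 1 N - {0}"
    and nonempty: "A \<noteq> {}" "B \<noteq> {}"
    and small: "[v *o A \<subseteq> {- M..M}] (mod m)" "[u *o B \<subseteq> {- M'..M'}] (mod m)"
    and g: "[u * v = g] (mod m)" "coprime g m" "0 < g" and m: "2 * (M * M') + g * int N < m"
  obtains n' where "[n' = g * n] (mod m)"
    and "small_reps m M (v *o A) * small_reps m M' (u *o B) = progression n' g N - {0}"
proof -
  define P where "P = small_reps m M (v *o A) * small_reps m M' (u *o B)"
  note P_cong = small_reps_times_cong[OF small g(1), folded P_def]
  have P_bounded: "P \<subseteq> {- (M * M')..M * M'}" unfolding P_def by (rule small_reps_times_subset)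
  obtain a b where ab: "a \<in> A" "b \<in> B" using nonempty by blast
  then have "(a * b) mod m \<in> (\<lambda>x. x mod m) ` (A * B)" by blast
  then have "(a * b) mod m \<in> (\<lambda>x. x mod m) ` progression n 1 N" unfolding product by blast
  then obtain i where i: "i \<in> {1..N}" "[a * b = n + int i] (mod m)"
    unfolding progression_def cong_def by auto
  have "g * (a * b) \<in> g *o (A * B)" using ab by blast
  with P_cong(2) obtain z where z: "z \<in> P" "[g * (a * b) = z] (mod m)" by (rule cong_subsetE)
  define n' where "n' = z - g * int i"
  have "[z = g * (n + int i)] (mod m)"
    using cong_trans[OF cong_sym[OF z(2)] cong_scalar_left[OF i(2)]] .
  then have n': "[n' = g * n] (mod m)"
    unfolding n'_def using cong_diff[of z "g * (n + int i)" m "g * int i" "g * int i"]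
    by (simp add: algebra_simps)
  have "z \<in> progression n' g N" using i(1) unfolding progression_def n'_def by force
  moreover have "z \<in> {- (M * M')..M * M'}" using z(1) P_bounded by blast
  ultimately have bounded: "progression n' g N \<subseteq> {- (M * M' + g * int N)..M * M' + g * int N}"
    using g(3) by (intro progression_bounded_if_mem) auto
  have "0 \<le> g * int N" using g(3) by simp
  then have cong: "[g *o (A * B) \<subseteq> progression n' g N - {0}] (mod m)"
    "[progression n' g N - {0} \<subseteq> g *o (A * B)] (mod m)"
    using progression_cong_scaled[OF product g(2) n' bounded] z(1) P_bounded m by force+
  have bounded': "progression n' g N - {0} \<subseteq> {- (M * M' + g * int N)..M * M' + g * int N}"
    using bounded by blast
  have "P \<subseteq> progression n' g N - {0}"
    using cong_subset_imp_subset[OF cong_subset_trans[OF P_cong(1) cong(1)] P_bounded bounded'] m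
    by simp
  moreover have "progression n' g N - {0} \<subseteq> P"
    using cong_subset_imp_subset[OF cong_subset_trans[OF cong(2) P_cong(2)] bounded' P_bounded] m
    by simp
  ultimately show thesis using that n' unfolding P_def by blast
qed

definition antipodal_pair :: "int \<Rightarrow> int set \<Rightarrow> bool" where
  "antipodal_pair m S \<longleftrightarrow> (\<exists>r. S = {(- r) mod m, r mod m})"

lemma antipodal_pair_if_scaled:
  assumes v: "coprime v m" and scaled: "[v *o A \<subseteq> {- r, r}] (mod m)"
    and A: "A \<subseteq> {0<..<m}" "2 \<le> card A"
  shows "antipodal_pair m A"
proof -
  obtain c where c: "[c * v = 1] (mod m)"
    using cong_solve_coprime_int[OF v] by (auto simp: mult.commute)
  have "[A \<subseteq> c *o (v *o A)] (mod m)"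
    unfolding set_times_rearrange2 using c by (rule cong_subset_elt_set_times_if_cong_1)
  also have "[c *o (v *o A) \<subseteq> c *o {- r, r}] (mod m)"
    using scaled by (simp add: cong_subset_elt_set_times)
  also have "c *o {- r, r} \<subseteq> {- (c * r), c * r}" by (auto simp: elt_set_times_def)
  finally have "(\<lambda>x. x mod m) ` A \<subseteq> {(- (c * r)) mod m, (c * r) mod m}"
    by (simp add: cong_subset_iff_image_mod)
  moreover have "x mod m = x" if "x \<in> A" for x using that A(1) by auto
  ultimately have "A \<subseteq> {(- (c * r)) mod m, (c * r) mod m}" by (auto simp: image_subset_iff)
  then show ?thesis unfolding antipodal_pair_def using eq_pair_if_card_ge_2[OF A(2)] by blast
qed

lemma filled_progressions_bounds:
  fixes g l l' m K N :: int
  assumes pos: "0 < l" "0 < l'" "0 < g" "0 < K" "0 < N"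
    and N: "N \<le> 18 * (l * l')" and g: "g * (l * l') \<le> 2 * (K * (K * N))"
    and m: "72 * (K * (K * N)) < m"
  shows "2 * ((K * N div l') * (K * N div l)) + g * N < m"
    and "2 * (K * N div l') + g * l < m" "2 * (K * N div l) + g * l' < m"
proof -
  define W where "W = K * (K * N)"
  have KN: "0 \<le> K * N" "K * N \<le> W" using pos unfolding W_def by simp_all
  have div_times_le: "K * N div k * k \<le> K * N" if "0 < k" for k
    using minus_mod_eq_div_mult[of "K * N" k] pos_mod_sign[OF that, of "K * N"] by linarith
  have "(K * N div l' * l') * (K * N div l * l) \<le> (K * N) * (K * N)"
    by (intro mult_mono div_times_le pos) (use KN pos in \<open>simp_all add: pos_imp_zdiv_nonneg_iff\<close>)
  also have "\<dots> = W * N" unfolding W_def by simp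
  also have "\<dots> \<le> W * (18 * (l * l'))" using N KN by (intro mult_left_mono) auto
  finally have "((K * N div l') * (K * N div l)) * (l * l') \<le> (18 * W) * (l * l')"
    by (simp add: mult_ac)
  then have "(K * N div l') * (K * N div l) \<le> 18 * W" using pos by (simp add: mult_le_cancel_right)
  moreover have "g * N \<le> g * (18 * (l * l'))" using N pos(3) by (intro mult_left_mono) auto
  then have "g * N \<le> 36 * W" using g unfolding W_def by (simp add: mult_ac)
  ultimately show "2 * ((K * N div l') * (K * N div l)) + g * N < m"
    using m unfolding W_def by linarith
  have "K * N div k \<le> W" if "0 < k" for k
    using zdiv_mono2[of "K * N" 1 k] that KN by simp
  then have "K * N div l \<le> W" "K * N div l' \<le> W" using pos by blast+
  moreover have "g * l \<le> g * (l * l')" "g * l' \<le> g * (l * l')" using pos by simp_all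
  ultimately show "2 * (K * N div l') + g * l < m" "2 * (K * N div l) + g * l' < m"
    using g m KN unfolding W_def by linarith+
qed

lemma scaled_factor_small_reps:
  assumes A: "A \<subseteq> {0<..<m}" "2 \<le> card A" and v: "coprime v m"
    and small: "[v *o A \<subseteq> {- M..M}] (mod m)"
    and diff: "[diff_set A \<subseteq> u *o {- l..l}] (mod m)"
    and g: "[v * u = g] (mod m)" "0 \<le> g" and m: "2 * M + g * l < m"
  shows "2 \<le> card (small_reps m M (v *o A))"
    and "x \<in> small_reps m M (v *o A) \<Longrightarrow> y \<in> small_reps m M (v *o A) \<Longrightarrow> [x = y] (mod g)"
    and "small_reps m M (v *o A) = {- r, r} \<Longrightarrow> antipodal_pair m A"
proof -
  have "card A \<le> card (small_reps m M (v *o A))"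
    using card_le_card_small_reps[OF subset_refl inj_on_mod_if_residues[OF A(1)] v small] .
  then show "2 \<le> card (small_reps m M (v *o A))" using A(2) by simp
  show "[x = y] (mod g)" if "x \<in> small_reps m M (v *o A)" "y \<in> small_reps m M (v *o A)"
  proof -
    have "x - y \<in> diff_set (small_reps m M (v *o A))" using that unfolding diff_set_def by blast
    also have "\<dots> \<subseteq> g *o {- l..l}" by (rule diff_set_small_reps_subset[OF diff g m])
    finally show ?thesis by (auto simp: elt_set_times_def cong_iff_dvd_diff)
  qed
  show "antipodal_pair m A" if "small_reps m M (v *o A) = {- r, r}"
    using antipodal_pair_if_scaled[OF v _ A] cong_subset_small_reps[OF small] unfolding that
    by blast
qed

lemma three_times_middle_cong:
  fixes g n n' m :: int
  assumes n': "[n' = g * n] (mod m)" and g: "coprime g m" and middle: "\<bar>3 * (n' + 2 * g)\<bar> = g"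
  shows "[3 * (n + 2) = 1] (mod m) \<or> [3 * (n + 2) = - 1] (mod m)"
proof -
  have "[3 * (g * n + 2 * g) = 3 * (n' + 2 * g)] (mod m)"
    using cong_sym[OF n'] by (intro cong_scalar_left cong_add cong_refl)
  then have "[g * (3 * (n + 2)) = 3 * (n' + 2 * g)] (mod m)" by (simp add: algebra_simps)
  moreover have "3 * (n' + 2 * g) = g * 1 \<or> 3 * (n' + 2 * g) = g * - 1" using middle by linarith
  ultimately show ?thesis using cong_mult_lcancel[OF g] by metis
qed

theorem product_eq_interval_cases:
  assumes m: "prime m" and A: "A \<subseteq> {0<..<m}" "2 \<le> card A" and B: "B \<subseteq> {0<..<m}" "2 \<le> card B"
    and product: "(\<lambda>x. x mod m) ` (A * B) = (\<lambda>x. x mod m) ` progression n 1 N - {0}"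
    and N: "0 < N" "int N \<le> 2 * int (card A * card B)" "10 ^ 9 * int N \<le> m"
  shows "antipodal_pair m A \<or> antipodal_pair m B \<or>
    (N = 3 \<and> ([3 * (n + 2) = 1] (mod m) \<or> [3 * (n + 2) = - 1] (mod m)))"
proof -
  have "[A * B \<subseteq> progression n 1 N] (mod m)" unfolding cong_subset_iff_image_mod product by blast
  then have small: "[diff_set (A * B) \<subseteq> {- int N..int N}] (mod m)"
    using cong_subset_diff_set_progression[of _ n 1 N m] by simp
  define K :: nat where "K = 6 * 192"
  have N_pos: "0 < int N" and K_pos: "0 < int K" and m_large: "72 * (int K * (int K * int N)) < m"
    using N(1,3) unfolding K_def by simp_all
  moreover have "0 \<le> int K * (int K * int N)" by simp
  ultimately have "6 * (int K * (int K * int N)) < m" by linarith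
  then obtain u l v l' g where u: "fills_progression m K (diff_set A) u l"
    and v: "fills_progression m K (diff_set B) v l'"
    and uB: "[u *o B \<subseteq> {- (int K * int N div l)..int K * int N div l}] (mod m)"
    and vA: "[v *o A \<subseteq> {- (int K * int N div l')..int K * int N div l'}] (mod m)"
    and g: "[u * v = g] (mod m)" "0 < g"
    and bounds: "int N \<le> 18 * (l * l')" "g * (l * l') \<le> 2 * (int K * (int K * int N))"
    by (rule factors_fill_progressions[OF m A B small K_def order_refl N_pos N(2)])
  have pos: "0 < l" "0 < l'" and coprime: "coprime u m" "coprime v m"
    and diffs: "[diff_set A \<subseteq> u *o {- l..l}] (mod m)" "[diff_set B \<subseteq> v *o {- l'..l'}] (mod m)"
    using u v unfolding fills_progression_def by blast+
  note lift_bounds = filled_progressions_bounds[OF pos g(2) K_pos N_pos bounds m_large]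
  have "A \<noteq> {}" "B \<noteq> {}" using A(2) B(2) by auto
  have coprime_g: "coprime g m" using cong_imp_coprime[OF g(1)] coprime by simp
  obtain n' where n': "[n' = g * n] (mod m)"
    and lift: "small_reps m (int K * int N div l') (v *o A)
      * small_reps m (int K * int N div l) (u *o B) = progression n' g N - {0}"
    by (rule small_reps_times_eq_progression[OF product \<open>A \<noteq> {}\<close> \<open>B \<noteq> {}\<close> vA uB
          g(1) coprime_g g(2) lift_bounds(1)])
  have g': "[v * u = g] (mod m)" "0 \<le> g" using g by (simp_all add: mult.commute)
  note A_lift = scaled_factor_small_reps[OF A coprime(2) vA diffs(1) g' lift_bounds(2)]
    and B_lift = scaled_factor_small_reps[OF B coprime(1) uB diffs(2) g(1) g'(2) lift_bounds(3)]
  show ?thesis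
    using progression_product_cases[OF g(2) A_lift(2) B_lift(2) A_lift(1) B_lift(1) lift]
      A_lift(3) B_lift(3) three_times_middle_cong[OF n' coprime_g] by blast
qed

section \<open>Intervals in the prime field\<close>

lemma interval_mod_eq_image: "interval_mod p n N = (\<lambda>x. x mod int p) ` progression n 1 N"
  unfolding interval_mod_def progression_def by auto

lemma le_card_interval_mod:
  assumes "0 < p"
  shows "min N p \<le> card (interval_mod p n N)"
proof -
  have "inj_on (\<lambda>i. (n + int i) mod int p) {1..min N p}"
  proof (rule inj_onI)
    fix i j assume ij: "i \<in> {1..min N p}" "j \<in> {1..min N p}"
      "(n + int i) mod int p = (n + int j) mod int p"
    then have "[n + int i = n + int j] (mod int p)" by (simp add: cong_def)
    then have "[int i - 1 = int j - 1] (mod int p)"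
      by (intro cong_diff) (simp_all only: cong_add_lcancel cong_refl)
    then have "int i - 1 = int j - 1" using ij by (intro cong_less_imp_eq_int) auto
    then show "i = j" by simp
  qed
  then have "min N p = card ((\<lambda>i. (n + int i) mod int p) ` {1..min N p})" by (simp add: card_image)
  also have "\<dots> \<le> card (interval_mod p n N)"
    unfolding interval_mod_eq_image progression_def by (intro card_mono) auto
  finally show ?thesis .
qed

lemma set_mult_Fp:
  assumes "prime p"
  shows "A <#>\<^bsub>Fp p\<^esub> B = (\<lambda>x. x mod int p) ` (A * B)"
proof -
  interpret residues_prime p "Fp p" by unfold_locales (rule assms)
  show ?thesis unfolding set_mult_def res_mult_eq set_times_def by auto
qed

lemma nontrivial_mult_decomp_by_iff:
  assumes p: "prime p"
  shows "nontrivial_mult_decomp_by p S A B \<longleftrightarrow>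
    A \<subseteq> {0..<int p} \<and> B \<subseteq> {0..<int p} \<and> 2 \<le> card A \<and> 2 \<le> card B \<and>
    S - {0} = (\<lambda>x. x mod int p) ` (A * B)"
proof -
  interpret residues_prime p "Fp p" by unfold_locales (rule assms)
  have "carrier (Fp p) = {0..<int p}" unfolding res_carrier_eq by auto
  then show ?thesis unfolding nontrivial_mult_decomp_by_def set_mult_Fp[OF p] res_zero_eq by simp
qed

lemma decomposition_cases:
  assumes p: "prime p" and N: "1 \<le> N" and card: "10 ^ 9 * card (interval_mod p n N) < p"
    and decomp: "nontrivial_mult_decomp_by p (interval_mod p n N) A B"
  shows "antipodal_pair (int p) A \<or> antipodal_pair (int p) B \<or>
    (N = 3 \<and> ([3 * (n + 2) = 1] (mod int p) \<or> [3 * (n + 2) = - 1] (mod int p)))"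
proof (rule product_eq_interval_cases)
  have p_pos: "0 < p" using p by (simp add: prime_gt_0_nat)
  have sub: "A \<subseteq> {0..<int p}" "B \<subseteq> {0..<int p}" and cards: "2 \<le> card A" "2 \<le> card B"
    and product: "interval_mod p n N - {0} = (\<lambda>x. x mod int p) ` (A * B)"
    using decomp unfolding nontrivial_mult_decomp_by_iff[OF p] by blast+
  then show "2 \<le> card A" "2 \<le> card B" by blast+
  show "(\<lambda>x. x mod int p) ` (A * B) = (\<lambda>x. x mod int p) ` progression n 1 N - {0}"
    using product unfolding interval_mod_eq_image ..
  have nonzero: "0 \<notin> (\<lambda>x. x mod int p) ` (A * B)" unfolding product[symmetric] by simp
  obtain a b where "a \<in> A" "b \<in> B" using cards by fastforce
  then have "0 \<notin> A" "0 \<notin> B"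
    using nonzero set_times_intro[of 0 A b B] set_times_intro[of a A 0 B] by force+
  then have "0 < x" if "x \<in> A \<union> B" for x using that sub by (cases "x = 0") auto
  then show "A \<subseteq> {0<..<int p}" "B \<subseteq> {0<..<int p}" using sub by auto
  have "min N p \<le> card (interval_mod p n N)" using p_pos by (rule le_card_interval_mod)
  then have N_le: "N \<le> card (interval_mod p n N)"
    using card by (auto simp: min_def split: if_splits)
  then have "10 ^ 9 * N \<le> p" using card by simp
  then show "10 ^ 9 * int N \<le> int p" by simp
  have "N - 1 \<le> card (interval_mod p n N - {0})"
    using N_le diff_card_le_card_Diff[of "{0}" "interval_mod p n N"] by simp
  also have "\<dots> \<le> card (A * B)"
    unfolding product using sub finite_subset by (intro card_image_le finite_set_times) blast+
  also have "\<dots> \<le> card A * card B"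
    unfolding set_times_image using sub finite_subset[of _ "{0..<int p}"]
    by (intro card_image_le[THEN le_trans]) (auto simp: card_cartesian_product)
  finally have "N \<le> card A * card B + 1" by simp
  also have "\<dots> \<le> 2 * (card A * card B)" using cards by (simp add: Suc_le_eq)
  finally have "int N \<le> int (2 * (card A * card B))" unfolding of_nat_le_iff .
  then show "int N \<le> 2 * int (card A * card B)" by simp
qed (use p N in auto)

lemma neg_set_Fp:
  assumes "prime p"
  shows "neg_set p S = (\<lambda>s. (- s) mod int p) ` S"
proof -
  interpret residues_prime p "Fp p" by unfold_locales (rule assms)
  show ?thesis unfolding neg_set_def res_neg_eq by auto
qed

lemma neg_set_set_mult:
  assumes p: "prime p" and sub: "A \<subseteq> carrier (Fp p)" "B \<subseteq> carrier (Fp p)"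
  shows "neg_set p (A <#>\<^bsub>Fp p\<^esub> B) = neg_set p A <#>\<^bsub>Fp p\<^esub> B"
proof -
  interpret residues_prime p "Fp p" by unfold_locales (rule p)
  have "neg_set p (A <#>\<^bsub>Fp p\<^esub> B) = (\<Union>a\<in>A. \<Union>b\<in>B. {\<ominus>\<^bsub>Fp p\<^esub> (a \<otimes>\<^bsub>Fp p\<^esub> b)})"
    unfolding neg_set_def set_mult_def by blast
  also have "\<dots> = (\<Union>a\<in>A. \<Union>b\<in>B. {(\<ominus>\<^bsub>Fp p\<^esub> a) \<otimes>\<^bsub>Fp p\<^esub> b})"
    using sub by (intro SUP_cong refl) (simp add: l_minus subset_iff)
  also have "\<dots> = neg_set p A <#>\<^bsub>Fp p\<^esub> B" unfolding neg_set_def set_mult_def by blast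
  finally show ?thesis .
qed

lemma neg_set_antipodal_pair:
  assumes "prime p" "antipodal_pair (int p) S"
  shows "neg_set p S = S"
  using assms(2) unfolding neg_set_Fp[OF assms(1)] antipodal_pair_def by (auto simp: mod_minus_eq)

lemma antipodal_pair_Fp:
  assumes "prime p" "antipodal_pair (int p) S"
  obtains r where "r \<in> carrier (Fp p)" "S = {\<ominus>\<^bsub>Fp p\<^esub> r, r}"
proof -
  interpret residues_prime p "Fp p" by unfold_locales (rule assms(1))
  obtain r where "S = {(- r) mod int p, r mod int p}"
    using assms(2) unfolding antipodal_pair_def by blast
  then show thesis using that[of "r mod int p"] by (simp add: neg_cong)
qed

lemma neg_set_eq_if_antipodal_factor:
  assumes p: "prime p" and decomp: "nontrivial_mult_decomp_by p S A B"
    and antipodal: "antipodal_pair (int p) A \<or> antipodal_pair (int p) B"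
  shows "neg_set p S = S"
proof -
  interpret residues_prime p "Fp p" by unfold_locales (rule p)
  have sub: "A \<subseteq> carrier (Fp p)" "B \<subseteq> carrier (Fp p)" and product: "S - {0} = A <#>\<^bsub>Fp p\<^esub> B"
    using decomp unfolding nontrivial_mult_decomp_by_def res_zero_eq by blast+
  have "A <#>\<^bsub>Fp p\<^esub> B = B <#>\<^bsub>Fp p\<^esub> A" by (simp add: set_mult_Fp[OF p] mult.commute)
  then have "neg_set p (S - {0}) = S - {0}"
    using antipodal neg_set_set_mult[OF p sub] neg_set_set_mult[OF p sub(2,1)]
      neg_set_antipodal_pair[OF p]
    unfolding product by auto
  moreover have "neg_set p (insert 0 T) = insert 0 (neg_set p T)" for T
    by (simp add: neg_set_Fp[OF p])
  ultimately show ?thesis by (cases "0 \<in> S") (metis insert_Diff_single insert_absorb, simp)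
qed

section \<open>The exceptional interval\<close>

lemma interval_mod_cong:
  assumes "[n = n'] (mod int p)"
  shows "interval_mod p n N = interval_mod p n' N"
proof -
  have "(n + int i) mod int p = (n' + int i) mod int p" for i
    using assms by (metis cong_add cong_def cong_refl)
  then show ?thesis unfolding interval_mod_def by simp
qed

lemma neg_set_interval_mod:
  assumes "prime p"
  shows "neg_set p (interval_mod p n N) = interval_mod p (- n - (int N + 1)) N"
proof -
  have "neg_set p (interval_mod p n N) = (\<lambda>x. x mod int p) ` uminus ` progression n 1 N"
    unfolding neg_set_Fp[OF assms] interval_mod_eq_image image_image by (simp add: mod_minus_eq)
  then show ?thesis unfolding uminus_progression interval_mod_eq_image by simp
qed

lemma interval_mod_3:
  "interval_mod p n 3 = {(n + 1) mod int p, (n + 2) mod int p, (n + 3) mod int p}"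
proof -
  have "{1..3} = {1, 2, 3::nat}" by auto
  then show ?thesis unfolding interval_mod_eq_image progression_def by simp
qed

lemma exceptional_set_eq_interval_mod:
  assumes p: "prime p" "3 < p" and n: "[3 * (n + 2) = 1] (mod int p)"
  shows "exceptional_set p = interval_mod p n 3"
proof -
  interpret residues_prime p "Fp p" by unfold_locales (rule p)
  define t where "t = inv_mod p 3"
  have three: "3 \<in> Units (Fp p)" unfolding res_prime_units_eq using p(2) by auto
  have t: "t = inv\<^bsub>Fp p\<^esub> 3" unfolding t_def inv_mod_def using p(2) by simp
  have "3 \<otimes>\<^bsub>Fp p\<^esub> t = \<one>\<^bsub>Fp p\<^esub>" unfolding t using three by simp
  then have "[3 * t = 3 * (n + 2)] (mod int p)"
    using n p(2) unfolding res_mult_eq res_one_eq cong_def by simp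
  moreover have "coprime 3 (int p)" using coprime_if_residue[of "int p" 3] p by simp
  ultimately have cong: "[t = n + 2] (mod int p)" using cong_mult_lcancel by blast
  have "t \<in> carrier (Fp p)" unfolding t using three by simp
  then have "t mod int p = t" unfolding res_carrier_eq by simp
  then have "exceptional_set p = {(t - 1) mod int p, t mod int p, (t + 1) mod int p}"
    unfolding exceptional_set_def t_def[symmetric] a_minus_def res_neg_eq res_add_eq res_one_eq
    by (simp add: mod_add_right_eq)
  also have "\<dots> = interval_mod p (t - 2) 3" unfolding interval_mod_3 by (simp add: algebra_simps)
  also have "\<dots> = interval_mod p n 3"
    using cong_diff[OF cong cong_refl, of 2] by (intro interval_mod_cong) simp
  finally show ?thesis .
qed

lemma interval_mod_exceptional:
  assumes p: "prime p" "3 < p"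
    and n: "[3 * (n + 2) = 1] (mod int p) \<or> [3 * (n + 2) = - 1] (mod int p)"
  shows "interval_mod p n 3 = exceptional_set p \<or>
    interval_mod p n 3 = neg_set p (exceptional_set p)"
  using n
proof
  assume "[3 * (n + 2) = 1] (mod int p)"
  then show ?thesis using exceptional_set_eq_interval_mod[OF p] by blast
next
  assume "[3 * (n + 2) = - 1] (mod int p)"
  then have "[- (3 * (n + 2)) = - (- 1)] (mod int p)" by (rule cong_uminus)
  moreover have "- (3 * (n + 2)) = 3 * ((- n - 4) + 2)" by simp
  ultimately have "[3 * ((- n - 4) + 2) = 1] (mod int p)" by (simp only: minus_minus)
  then have "exceptional_set p = interval_mod p (- n - 4) 3"
    by (rule exceptional_set_eq_interval_mod[OF p])
  then show ?thesis by (simp add: neg_set_interval_mod[OF p(1)])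
qed

lemma exceptional_interval_mod_not_symmetric:
  assumes p: "prime p" "8 < p"
    and n: "[3 * (n + 2) = 1] (mod int p) \<or> [3 * (n + 2) = - 1] (mod int p)"
  shows "neg_set p (interval_mod p n 3) \<noteq> interval_mod p n 3"
proof
  assume sym: "neg_set p (interval_mod p n 3) = interval_mod p n 3"
  obtain e where e: "e \<in> {1, - 1}" "[3 * (n + 2) = e] (mod int p)" using n by blast
  have "(n + 1) mod int p \<in> interval_mod p (- n - 4) 3"
    using sym unfolding neg_set_interval_mod[OF p(1)] by (simp add: interval_mod_3)
  then obtain j where j: "j \<in> {1, 2, 3}" "[n + 1 = - n - 4 + j] (mod int p)"
    unfolding interval_mod_3 cong_def by blast
  have "int p dvd (n + 1) - (- n - 4 + j)" "int p dvd 3 * (n + 2) - e"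
    using j(2) e(2) by (simp_all add: cong_iff_dvd_diff)
  then have "int p dvd 3 * ((n + 1) - (- n - 4 + j)) - 2 * (3 * (n + 2) - e)"
    by (rule dvd_diff[OF dvd_mult dvd_mult])
  also have "3 * ((n + 1) - (- n - 4 + j)) - 2 * (3 * (n + 2) - e) = 3 - 3 * j + 2 * e"
    by (simp add: algebra_simps)
  finally have "int p dvd 3 - 3 * j + 2 * e" .
  moreover have "3 - 3 * j + 2 * e \<noteq> 0" "\<bar>3 - 3 * j + 2 * e\<bar> \<le> 8" using e(1) j(1) by auto
  ultimately show False using dvd_imp_le_int[of "3 - 3 * j + 2 * e" "int p"] p(2) by auto
qed

theorem theorem1:
  shows "\<exists>c::real. c > 0 \<and>
    (\<forall>p::nat. prime p \<longrightarrow>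
      (\<forall>(n::int) (N::nat) I. N \<ge> 1 \<longrightarrow> I = interval_mod p n N \<longrightarrow>
         real (card I) < c * real p \<longrightarrow>
         has_nontrivial_mult_decomp p I \<longrightarrow>
         (I = exceptional_set p \<or> I = neg_set p (exceptional_set p) \<or> I = neg_set p I) \<and>
         (I = neg_set p I \<longrightarrow>
           (\<forall>A B. nontrivial_mult_decomp_by p I A B \<longrightarrow>
             (\<exists>r\<in>carrier (Fp p). A = {\<ominus>\<^bsub>Fp p\<^esub> r, r} \<or> B = {\<ominus>\<^bsub>Fp p\<^esub> r, r})))))"
proof (intro exI[of _ "1 / 10 ^ 9"] conjI allI impI)
  fix p :: nat and n :: int and N :: nat and I
  assume p: "prime p" and N: "1 \<le> N" and I: "I = interval_mod p n N"
    and "real (card I) < 1 / 10 ^ 9 * real p"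
  then have "real (10 ^ 9 * card I) < real p" by simp
  then have card: "10 ^ 9 * card (interval_mod p n N) < p" unfolding I of_nat_less_iff .
  have "1 \<le> card I" using le_card_interval_mod[of p N n] N prime_gt_0_nat[OF p] unfolding I by simp
  then have "8 < p" using card unfolding I by simp
  note cases = decomposition_cases[OF p N card, folded I]
    and not_symmetric = exceptional_interval_mod_not_symmetric[OF p \<open>8 < p\<close>, of n]
  show "I = exceptional_set p \<or> I = neg_set p (exceptional_set p) \<or> I = neg_set p I"
    if "has_nontrivial_mult_decomp p I"
    using that cases neg_set_eq_if_antipodal_factor[OF p] interval_mod_exceptional[OF p, of n]
      \<open>8 < p\<close> I
    unfolding has_nontrivial_mult_decomp_def by fastforce
  show "\<exists>r\<in>carrier (Fp p). A = {\<ominus>\<^bsub>Fp p\<^esub> r, r} \<or> B = {\<ominus>\<^bsub>Fp p\<^esub> r, r}"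
    if "I = neg_set p I" "nontrivial_mult_decomp_by p I A B" for A B
    using cases[OF that(2)] that(1) not_symmetric antipodal_pair_Fp[OF p] unfolding I by metis
qed simp

end
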